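(* Let $E$ be a de Branges function, written as $$E(z)=\gamma\,G(z)\,e^{-i\sigma z}\prod_{n=1}^\infty\Big(1-\frac{z}{\overline{z_n}}\Big)e^{\frac12(p_n(z)+p_n^*(z))},$$ where $(\overline{z_n})$ are the zeros of $E$ in the open lower half-plane (so $z_n$ lies in the open upper half-plane), ordered with $|z_n|\le|z_{n+1}|$ and satisfying $\sum_n|\mathrm{Im}(1/z_n)|<\infty$, $\sigma\ge 0$, $|\gamma|=1$, $p_n(z)=\sum_{k=1}^n\frac{z^k}{k\,\overline{z_n}^k}$, and $G$ is an entire function with $G=G^*$ whose zeros are real. Then multiplication by $z$ in $\mathcal{H}(E)$ is densely defined if and only if at least one of the following holds: (i) $\sigma>0$; (ii) $\sum_n\mathrm{Im}(z_n)=\infty$.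
   Context: A de Branges function is an entire function $E$ with $|E(z)|>|E(\overline z)|$ for all $z$ in the open upper half-plane $\mathbb{U}$; $f^*(z)=\overline{f(\overline z)}$. The de Branges space $\mathcal{H}(E)$ is the Hilbert space of entire functions $f$ with $f/E,f^*/E\in H^2(\mathbb{U})$, with inner product $\langle f,g\rangle=\int_{\mathbb{R}}f\overline g\,|E|^{-2}dx$. Multiplication by $z$ in $\mathcal{H}(E)$ is $f\mapsto zf$ on the maximal domain $\{f\in\mathcal{H}(E): zf\in\mathcal{H}(E)\}$. *)

theory Defs
  imports "HOL-Analysis.Analysis"
begin

definition star_fun :: "(complex \<Rightarrow> complex) \<Rightarrow> complex \<Rightarrow> complex" where
  "star_fun f = (\<lambda>z. cnj (f (cnj z)))"

definition upper_half :: "complex set" where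
  "upper_half = {z. Im z > 0}"

definition de_branges_fun :: "(complex \<Rightarrow> complex) \<Rightarrow> bool" where
  "de_branges_fun E \<longleftrightarrow> E holomorphic_on UNIV \<and>
     (\<forall>z. Im z > 0 \<longrightarrow> cmod (E z) > cmod (star_fun E z))"

definition hardy2_upper :: "(complex \<Rightarrow> complex) \<Rightarrow> bool" where
  "hardy2_upper g \<longleftrightarrow> g holomorphic_on upper_half \<and>
     (\<exists>C. \<forall>y>0. integrable lborel (\<lambda>x::real. (cmod (g (Complex x y)))\<^sup>2) \<and>
                (\<integral>x. (cmod (g (Complex x y)))\<^sup>2 \<partial>lborel) \<le> C)"

definition dB_space :: "(complex \<Rightarrow> complex) \<Rightarrow> (complex \<Rightarrow> complex) set" where
  "dB_space E = {f. f holomorphic_on UNIV \<and> hardy2_upper (\<lambda>z. f z / E z)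
                     \<and> hardy2_upper (\<lambda>z. star_fun f z / E z)}"

definition dB_norm2 :: "(complex \<Rightarrow> complex) \<Rightarrow> (complex \<Rightarrow> complex) \<Rightarrow> real" where
  "dB_norm2 E f = (\<integral>x. (cmod (f (complex_of_real x)))\<^sup>2 / (cmod (E (complex_of_real x)))\<^sup>2 \<partial>lborel)"

definition mult_z_domain :: "(complex \<Rightarrow> complex) \<Rightarrow> (complex \<Rightarrow> complex) set" where
  "mult_z_domain E = {f \<in> dB_space E. (\<lambda>z. z * f z) \<in> dB_space E}"

definition mult_z_densely_defined :: "(complex \<Rightarrow> complex) \<Rightarrow> bool" where
  "mult_z_densely_defined E \<longleftrightarrow>
     (\<forall>f \<in> dB_space E. \<forall>\<epsilon>>0. \<exists>g \<in> mult_z_domain E. dB_norm2 E (\<lambda>z. f z - g z) < \<epsilon>)"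

definition dB_p :: "complex \<Rightarrow> nat \<Rightarrow> complex \<Rightarrow> complex" where
  "dB_p a n z = (\<Sum>k=1..n. z ^ k / (of_nat k * cnj a ^ k))"

definition dB_factor :: "complex \<Rightarrow> nat \<Rightarrow> complex \<Rightarrow> complex" where
  "dB_factor a n z = (1 - z / cnj a) * exp ((dB_p a n z + star_fun (dB_p a n) z) / 2)"

end

theory Submission
  imports Defs "HOL-Complex_Analysis.Complex_Analysis" "HOL-Real_Asymp.Real_Asymp"
begin

text \<open>
  Dividing by \<open>E\<close> turns \<open>\<H>(E)\<close> into the model space of the inner function \<open>\<Theta> = E\<^sup>* / E\<close>, and
  everything depends on \<open>n (1 - |\<Theta>(i n)|\<^sup>2)\<close>. The exponentials of the Weierstrass product
  cancel in \<open>|\<Theta>|\<close>, which is therefore \<open>exp (- 2 \<sigma> Im z)\<close> times a Blaschke product; so this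
  quantity is bounded if \<open>\<sigma> = 0\<close> and \<open>\<Sum> Im z\<^sub>n\<close> converges, and tends to infinity otherwise.

  If it tends to infinity, the normalised reproducing kernels at \<open>w = i n\<close> tend weakly to zero, so
  \<open>w (f - c K\<^sub>w) / (w - z)\<close>, with \<open>c\<close> cancelling the pole, is an element of the domain close to \<open>f\<close>.
  If it is bounded, the rescaled kernels converge along a subsequence to \<open>1 - cnj c \<Theta>\<close> with
  \<open>|c| = 1\<close>, so by Fatou's lemma \<open>E - cnj c E\<^sup>*\<close> is a non-zero element of \<open>\<H>(E)\<close>; it is
  orthogonal to the domain since \<open>f / E\<close> has integral zero whenever \<open>z f / E\<close> is also in the
  Hardy space.
\<close>

subsection \<open>Integrals and the Hardy space\<close>

text \<open>In the model space the kernel at \<open>w\<close> has squared norm proportional to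
  \<open>(1 - |Theta w|^2) / Im w\<close>. Rescaling by \<open>n\<close> at \<open>w = i n\<close>,
  which is what keeps the kernel from decaying pointwise, turns this into
  \<open>n (1 - |Theta|^2)\<close>. A bound on that quantity is therefore a norm bound for the
  rescaled kernels. If it diverges, the norms decay more slowly than \<open>1 / n\<close> while the
  kernels are at most \<open>2 / n\<close> on the real line, so the normalised kernels tend to zero
  uniformly there. One Blaschke factor with zero \<open>a\<close> contributes \<open>4 Im a\<close>
  in the limit, which is the origin of the sum of imaginary parts.

  The obstacle is the real line: the Hardy condition speaks of lines inside the half-plane, the norm
  of the boundary, and \<open>E\<close> may have real zeros. As \<open>f\<close> and
  \<open>E\<close> are entire, \<open>f / E\<close> is meromorphic, and the Hardy bound excludes
  real poles; so the quotients extend holomorphically to the closed half-plane. Cauchy's theorem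
  then applies to rectangles standing on the real line, and ordinary continuity supplies the
  boundary values.\<close>

lemma integral_Cauchy_density:
  fixes a b :: real
  assumes "b > 0"
  shows "integrable lborel (\<lambda>x. 1 / ((x - a)\<^sup>2 + b\<^sup>2))"
    and "(\<integral>x. 1 / ((x - a)\<^sup>2 + b\<^sup>2) \<partial>lborel) = pi / b"
proof -
  let ?f = "\<lambda>x. 1 / ((x - a)\<^sup>2 + b\<^sup>2)"
  let ?F = "\<lambda>x. arctan ((x - a) / b) / b"
  have pos: "(x - a)\<^sup>2 + b\<^sup>2 > 0" for x
    using assms by (simp add: add_nonneg_pos)
  have D: "DERIV ?F x :> ?f x" for x
  proof -
    have "(inverse (1 + ((x - a) / b)\<^sup>2) * (1 / b)) / b = ?f x"
      using assms pos[of x] by (simp add: divide_simps power2_eq_square)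
    then show ?thesis
      using assms by (auto intro!: derivative_eq_intros)
  qed
  have C: "isCont ?f x" for x
    using pos[of x] by (intro continuous_intros) auto
  have top: "(?F \<longlongrightarrow> pi * inverse b / 2) at_top"
    using assms by real_asymp
  have bot: "(?F \<longlongrightarrow> - (pi * inverse b / 2)) at_bot"
    using assms by real_asymp
  have top': "((?F \<circ> real_of_ereal) \<longlongrightarrow> pi * inverse b / 2) (at_left \<infinity>)"
    using top by (simp add: ereal_tendsto_simps1)
  have bot': "((?F \<circ> real_of_ereal) \<longlongrightarrow> - (pi * inverse b / 2)) (at_right (-\<infinity>))"
    using bot by (simp add: ereal_tendsto_simps1)
  have ev: "einterval (-\<infinity>) \<infinity> = (UNIV :: real set)"
    by (auto simp: einterval_def)
  note FTC = interval_integral_FTC_nonneg[of "-\<infinity>" \<infinity>, OF _ D C _ bot' top']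
  have "set_integrable lborel (einterval (-\<infinity>) \<infinity>) ?f"
    by (rule FTC(1)) (use pos in \<open>auto intro!: AE_I2 less_imp_le\<close>)
  then show "integrable lborel ?f"
    by (simp add: ev set_integrable_def)
  have "(LBINT x=-\<infinity>..\<infinity>. ?f x) = pi * inverse b / 2 - - (pi * inverse b / 2)"
    by (rule FTC(2)) (use pos in \<open>auto intro!: AE_I2 less_imp_le\<close>)
  then show "(\<integral>x. ?f x \<partial>lborel) = pi / b"
    using assms by (simp add: interval_lebesgue_integral_def ev set_lebesgue_integral_def field_simps)
qed

lemma cmod_Complex_diff: "(cmod (Complex x y - w))\<^sup>2 = (x - Re w)\<^sup>2 + (y - Im w)\<^sup>2"
  by (simp add: cmod_power2)

lemma integral_inverse_distance_square:
  assumes "y \<noteq> Im w"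
  shows "integrable lborel (\<lambda>x. 1 / (cmod (Complex x y - w))\<^sup>2)"
    and "(\<integral>x. 1 / (cmod (Complex x y - w))\<^sup>2 \<partial>lborel) = pi / \<bar>y - Im w\<bar>"
  using integral_Cauchy_density[of "\<bar>y - Im w\<bar>" "Re w"] assms
  by (simp_all add: cmod_Complex_diff)

text \<open>Fatou's lemma packaged with integrability of the limit. It serves two limits: heights
  tending to the real line, and rescaled kernels along a subsequence.\<close>

lemma fatou_bounded:
  fixes u :: "nat \<Rightarrow> 'a \<Rightarrow> real"
  assumes int: "\<And>n. integrable M (u n)"
    and nonneg: "\<And>n x. 0 \<le> u n x"
    and bound: "\<And>n. (\<integral>x. u n x \<partial>M) \<le> C"
    and lim: "AE x in M. (\<lambda>n. u n x) \<longlonglongrightarrow> v x"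
    and meas: "v \<in> borel_measurable M"
  shows "integrable M v" and "(\<integral>x. v x \<partial>M) \<le> C"
proof -
  have nonneg_v: "AE x in M. 0 \<le> v x"
    using lim by eventually_elim (meson LIMSEQ_le_const nonneg)
  have C: "0 \<le> C"
    using bound[of 0] integral_nonneg_AE[of "u 0" M] nonneg by (smt (verit) AE_I2)
  have "(\<integral>\<^sup>+x. ennreal (v x) \<partial>M) = (\<integral>\<^sup>+x. liminf (\<lambda>n. ennreal (u n x)) \<partial>M)"
    using lim by (intro nn_integral_cong_AE)
      (auto elim!: eventually_mono intro!: lim_imp_Liminf[symmetric])
  also have "\<dots> \<le> liminf (\<lambda>n. \<integral>\<^sup>+x. ennreal (u n x) \<partial>M)"
    using int by (intro nn_integral_liminf) auto
  also have "\<dots> \<le> liminf (\<lambda>n. ennreal C)"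
    using bound nonneg int
    by (intro Liminf_mono always_eventually) (auto simp: nn_integral_eq_integral ennreal_leI)
  finally have le: "(\<integral>\<^sup>+x. ennreal (v x) \<partial>M) \<le> ennreal C"
    by (simp add: Liminf_const)
  then show iv: "integrable M v"
    using nonneg_v meas
    by (intro integrableI_nonneg) (auto simp: less_top[symmetric] top_unique)
  show "(\<integral>x. v x \<partial>M) \<le> C"
    using le nonneg_v C iv by (simp add: nn_integral_eq_integral)
qed

lemma integrable_mult_L2:
  fixes f g :: "'a \<Rightarrow> complex"
  assumes "f \<in> borel_measurable M" "g \<in> borel_measurable M"
    and "integrable M (\<lambda>x. (cmod (f x))\<^sup>2)" "integrable M (\<lambda>x. (cmod (g x))\<^sup>2)"
  shows "integrable M (\<lambda>x. f x * g x)"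
proof (rule Bochner_Integration.integrable_bound)
  show "integrable M (\<lambda>x. (cmod (f x))\<^sup>2 + (cmod (g x))\<^sup>2)"
    using assms by simp
  show "(\<lambda>x. f x * g x) \<in> borel_measurable M"
    using assms by simp
  have "a * b \<le> a\<^sup>2 + b\<^sup>2" if "0 \<le> a" "0 \<le> b" for a b :: real
    using sum_squares_bound[of a b] mult_nonneg_nonneg[OF that] by linarith
  then show "AE x in M. norm (f x * g x) \<le> norm ((cmod (f x))\<^sup>2 + (cmod (g x))\<^sup>2)"
    by (auto simp: norm_mult)
qed

lemma Cauchy_Schwarz_integral:
  fixes f g :: "'a \<Rightarrow> real"
  assumes meas: "f \<in> borel_measurable M" "g \<in> borel_measurable M"
    and nonneg: "\<And>x. 0 \<le> f x" "\<And>x. 0 \<le> g x"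
    and int: "integrable M (\<lambda>x. (f x)\<^sup>2)" "integrable M (\<lambda>x. (g x)\<^sup>2)"
  shows "(\<integral>x. f x * g x \<partial>M)\<^sup>2 \<le> (\<integral>x. (f x)\<^sup>2 \<partial>M) * (\<integral>x. (g x)\<^sup>2 \<partial>M)"
proof -
  have "integrable M (\<lambda>x. complex_of_real (f x) * complex_of_real (g x))"
    by (rule integrable_mult_L2) (use assms in auto)
  then have "integrable M (\<lambda>x. complex_of_real (f x * g x))" by simp
  then have fg: "integrable M (\<lambda>x. f x * g x)"
    using complex_of_real_integrable_eq by blast
  have "(\<integral>\<^sup>+x. ennreal (f x) * ennreal (g x) \<partial>M)\<^sup>2
      \<le> (\<integral>\<^sup>+x. ennreal (f x) ^ 2 \<partial>M) * (\<integral>\<^sup>+x. ennreal (g x) ^ 2 \<partial>M)"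
    using meas by (intro Cauchy_Schwarz_nn_integral) auto
  moreover have "(\<integral>\<^sup>+x. ennreal (f x) * ennreal (g x) \<partial>M) = ennreal (\<integral>x. f x * g x \<partial>M)"
    unfolding ennreal_mult[OF nonneg, symmetric]
    by (rule nn_integral_eq_integral[OF fg]) (simp add: nonneg)
  moreover have "(\<integral>\<^sup>+x. ennreal (f x) ^ 2 \<partial>M) = ennreal (\<integral>x. (f x)\<^sup>2 \<partial>M)"
    unfolding ennreal_power[OF nonneg(1)]
    by (rule nn_integral_eq_integral[OF int(1)]) simp
  moreover have "(\<integral>\<^sup>+x. ennreal (g x) ^ 2 \<partial>M) = ennreal (\<integral>x. (g x)\<^sup>2 \<partial>M)"
    unfolding ennreal_power[OF nonneg(2)]
    by (rule nn_integral_eq_integral[OF int(2)]) simp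
  moreover have "0 \<le> (\<integral>x. f x * g x \<partial>M)" "0 \<le> (\<integral>x. (f x)\<^sup>2 \<partial>M)" "0 \<le> (\<integral>x. (g x)\<^sup>2 \<partial>M)"
    using nonneg by simp_all
  ultimately show ?thesis
    by (simp only: ennreal_power ennreal_mult[symmetric] ennreal_le_iff mult_nonneg_nonneg)
qed

section \<open>Closure properties of the Hardy space\<close>

lemma open_upper_half: "open upper_half"
  unfolding upper_half_def by (rule open_halfspace_Im_gt)

lemma holomorphic_upper_half_measurable:
  assumes "g holomorphic_on upper_half" "y > 0"
  shows "(\<lambda>x. g (Complex x y)) \<in> borel_measurable lborel"
proof -
  have "continuous_on UNIV (\<lambda>x. g (Complex x y))"
    by (rule continuous_on_compose2[OF holomorphic_on_imp_continuous_on[OF assms(1)]])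
       (use assms(2) in \<open>auto simp: upper_half_def Complex_eq intro!: continuous_intros\<close>)
  then show ?thesis
    using borel_measurable_continuous_onI by simp
qed

lemma hardy2_upperE:
  assumes "hardy2_upper g"
  obtains C where "0 \<le> C" "\<And>y. y > 0 \<Longrightarrow> integrable lborel (\<lambda>x. (cmod (g (Complex x y)))\<^sup>2)"
    "\<And>y. y > 0 \<Longrightarrow> (\<integral>x. (cmod (g (Complex x y)))\<^sup>2 \<partial>lborel) \<le> C"
proof -
  from assms obtain C where C: "\<forall>y>0. integrable lborel (\<lambda>x::real. (cmod (g (Complex x y)))\<^sup>2) \<and>
                (\<integral>x. (cmod (g (Complex x y)))\<^sup>2 \<partial>lborel) \<le> C"
    unfolding hardy2_upper_def by blast
  have "0 \<le> (\<integral>x. (cmod (g (Complex x 1)))\<^sup>2 \<partial>lborel)"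
    by (intro integral_nonneg_AE) auto
  also have "\<dots> \<le> C" using C by simp
  finally show ?thesis using that[of C] C by auto
qed

lemma hardy2_upper_holomorphic: "hardy2_upper g \<Longrightarrow> g holomorphic_on upper_half"
  by (simp add: hardy2_upper_def)

text \<open>The majorant \<open>u y\<close> may change with the height; only the bound on its
  integral has to be uniform. Membership is thereby reduced to a pointwise estimate.\<close>

lemma hardy2_upper_dominated:
  assumes hol: "h holomorphic_on upper_half"
    and int: "\<And>y. y > 0 \<Longrightarrow> integrable lborel (u y)"
    and bound: "\<And>y. y > 0 \<Longrightarrow> (\<integral>x. u y x \<partial>lborel) \<le> C"
    and le: "\<And>x y. y > 0 \<Longrightarrow> (cmod (h (Complex x y)))\<^sup>2 \<le> u y x"
  shows "hardy2_upper h"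
  unfolding hardy2_upper_def
proof (intro conjI exI[of _ C] allI impI hol)
  fix y :: real assume y: "y > 0"
  show i: "integrable lborel (\<lambda>x. (cmod (h (Complex x y)))\<^sup>2)"
    by (rule Bochner_Integration.integrable_bound[OF int[OF y]])
       (use holomorphic_upper_half_measurable[OF hol y] le[OF y] in
         \<open>auto intro!: AE_I2 order_trans[OF _ abs_ge_self]\<close>)
  have "(\<integral>x. (cmod (h (Complex x y)))\<^sup>2 \<partial>lborel) \<le> (\<integral>x. u y x \<partial>lborel)"
    by (intro integral_mono i int y le)
  also have "\<dots> \<le> C" by (rule bound[OF y])
  finally show "(\<integral>x. (cmod (h (Complex x y)))\<^sup>2 \<partial>lborel) \<le> C" .
qed

lemma hardy2_upper_cong:
  assumes "\<And>z. Im z > 0 \<Longrightarrow> f z = g z"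
  shows "hardy2_upper f \<longleftrightarrow> hardy2_upper g"
proof -
  have "f holomorphic_on upper_half \<longleftrightarrow> g holomorphic_on upper_half"
    by (intro holomorphic_cong) (auto simp: upper_half_def assms)
  then show ?thesis
    using assms unfolding hardy2_upper_def by simp
qed

lemma hardy2_upper_mult_bounded:
  assumes F: "hardy2_upper F" and q: "q holomorphic_on upper_half"
    and M: "\<And>z. Im z > 0 \<Longrightarrow> cmod (q z) \<le> M"
  shows "hardy2_upper (\<lambda>z. q z * F z)"
proof -
  obtain C where "0 \<le> C" and C: "\<And>y. y > 0 \<Longrightarrow> integrable lborel (\<lambda>x. (cmod (F (Complex x y)))\<^sup>2)"
    "\<And>y. y > 0 \<Longrightarrow> (\<integral>x. (cmod (F (Complex x y)))\<^sup>2 \<partial>lborel) \<le> C"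
    by (rule hardy2_upperE[OF F]) (rule that)
  show ?thesis
  proof (rule hardy2_upper_dominated[where u = "\<lambda>y x. M\<^sup>2 * (cmod (F (Complex x y)))\<^sup>2" and C = "M\<^sup>2 * C"])
    show "(\<lambda>z. q z * F z) holomorphic_on upper_half"
      by (intro holomorphic_intros q hardy2_upper_holomorphic F)
    show "(cmod (q (Complex x y) * F (Complex x y)))\<^sup>2 \<le> M\<^sup>2 * (cmod (F (Complex x y)))\<^sup>2"
      if "y > 0" for x y
      using M[of "Complex x y"] that
      by (simp add: norm_mult power_mult_distrib mult_right_mono power_mono)
  qed (use C in \<open>auto intro: mult_left_mono\<close>)
qed

lemma hardy2_upper_add:
  assumes f: "hardy2_upper f" and g: "hardy2_upper g"
  shows "hardy2_upper (\<lambda>z. f z + g z)"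
proof -
  obtain C where "0 \<le> C" and C: "\<And>y. y > 0 \<Longrightarrow> integrable lborel (\<lambda>x. (cmod (f (Complex x y)))\<^sup>2)"
    "\<And>y. y > 0 \<Longrightarrow> (\<integral>x. (cmod (f (Complex x y)))\<^sup>2 \<partial>lborel) \<le> C"
    by (rule hardy2_upperE[OF f]) (rule that)
  obtain D where "0 \<le> D" and D: "\<And>y. y > 0 \<Longrightarrow> integrable lborel (\<lambda>x. (cmod (g (Complex x y)))\<^sup>2)"
    "\<And>y. y > 0 \<Longrightarrow> (\<integral>x. (cmod (g (Complex x y)))\<^sup>2 \<partial>lborel) \<le> D"
    by (rule hardy2_upperE[OF g]) (rule that)
  have sq: "(cmod (a + b))\<^sup>2 \<le> 2 * (cmod a)\<^sup>2 + 2 * (cmod b)\<^sup>2" for a b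
    using power_mono[OF norm_triangle_ineq[of a b], of 2] sum_squares_bound[of "cmod a" "cmod b"]
    by (simp add: power2_sum)
  show ?thesis
  proof (rule hardy2_upper_dominated[where C = "2 * C + 2 * D" and
        u = "\<lambda>y x. 2 * (cmod (f (Complex x y)))\<^sup>2 + 2 * (cmod (g (Complex x y)))\<^sup>2"])
    show "(\<lambda>z. f z + g z) holomorphic_on upper_half"
      by (intro holomorphic_intros hardy2_upper_holomorphic f g)
  qed (use C D sq in \<open>auto intro: add_mono\<close>)
qed

lemma hardy2_upper_scale:
  assumes "hardy2_upper f"
  shows "hardy2_upper (\<lambda>z. c * f z)"
  by (rule hardy2_upper_mult_bounded[OF assms, of "\<lambda>_. c" "cmod c"]) auto

text \<open>A point \<open>v\<close> below the real line has distance more than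
  \<open>- Im v\<close> from every line in the half-plane, so the explicit integral
  \<open>pi / (y - Im v)\<close> stays below \<open>pi / (- Im v)\<close>.\<close>

lemma hardy2_upper_le_inverse_distance:
  assumes hol: "h holomorphic_on upper_half" and v: "Im v < 0"
    and le: "\<And>z. Im z > 0 \<Longrightarrow> cmod (h z) \<le> M / cmod (z - v)"
  shows "hardy2_upper h"
proof (rule hardy2_upper_dominated[where C = "M\<^sup>2 * (pi / (- Im v))" and
        u = "\<lambda>y x. M\<^sup>2 * (1 / (cmod (Complex x y - v))\<^sup>2)"])
  fix y :: real assume y: "y > 0"
  then have ne: "y \<noteq> Im v" using v by simp
  show "integrable lborel (\<lambda>x. M\<^sup>2 * (1 / (cmod (Complex x y - v))\<^sup>2))"
    using integral_inverse_distance_square(1)[OF ne] by (rule integrable_mult_right)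
  have "pi / \<bar>y - Im v\<bar> \<le> pi / (- Im v)"
    using y v by (intro frac_le) auto
  then show "(\<integral>x. M\<^sup>2 * (1 / (cmod (Complex x y - v))\<^sup>2) \<partial>lborel) \<le> M\<^sup>2 * (pi / (- Im v))"
    by (subst integral_mult_right_zero, subst integral_inverse_distance_square(2)[OF ne])
       (rule mult_left_mono, auto)
  show "(cmod (h (Complex x y)))\<^sup>2 \<le> M\<^sup>2 * (1 / (cmod (Complex x y - v))\<^sup>2)" for x
    using power_mono[OF le[of "Complex x y"], of 2] y by (simp add: power_divide)
qed (rule hol)

lemma hardy2_upper_bounded_div:
  assumes hol: "h holomorphic_on upper_half" and v: "Im v < 0"
    and le: "\<And>z. Im z > 0 \<Longrightarrow> cmod (h z) \<le> M"
  shows "hardy2_upper (\<lambda>z. h z / (z - v))"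
proof (rule hardy2_upper_le_inverse_distance[OF _ v, of _ M])
  show "(\<lambda>z. h z / (z - v)) holomorphic_on upper_half"
    using v by (intro holomorphic_intros hol) (auto simp: upper_half_def)
qed (auto simp: norm_divide le divide_right_mono)

lemma hardy2_upper_div_lower:
  assumes F: "hardy2_upper F" and v: "Im v < 0"
  shows "hardy2_upper (\<lambda>z. F z / (z - v))"
proof -
  have "hardy2_upper (\<lambda>z. 1 / (z - v) * F z)"
  proof (rule hardy2_upper_mult_bounded[OF F, where M = "1 / (- Im v)"])
    show "(\<lambda>z. 1 / (z - v)) holomorphic_on upper_half"
      using v by (intro holomorphic_intros) (auto simp: upper_half_def)
    show "cmod (1 / (z - v)) \<le> 1 / (- Im v)" if "Im z > 0" for z
    proof -
      have "- Im v \<le> \<bar>Im (z - v)\<bar>" using that v by simp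
      also have "\<dots> \<le> cmod (z - v)" by (rule abs_Im_le_cmod)
      finally show ?thesis using v unfolding norm_divide norm_one by (intro frac_le) auto
    qed
  qed
  then show ?thesis by simp
qed

text \<open>Outside a disc of radius \<open>r\<close> around \<open>w\<close> the factor
  \<open>z - w\<close> has modulus at least \<open>r\<close>, so dividing by it costs only
  \<open>1 / r^2\<close>. Inside the disc \<open>h\<close> is bounded by compactness, and each line
  meets the disc above an interval of length at most \<open>2 * r\<close>.\<close>

lemma hardy2_upper_divisor:
  assumes hol: "h holomorphic_on upper_half" and w: "Im w > 0"
    and H: "hardy2_upper (\<lambda>z. (z - w) * h z)"
  shows "hardy2_upper h"
proof -
  define r where "r = Im w / 2"
  have r: "r > 0" using w by (simp add: r_def)
  have sub: "cball w r \<subseteq> upper_half"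
  proof
    fix z assume "z \<in> cball w r"
    then have "\<bar>Im (w - z)\<bar> \<le> r"
      using abs_Im_le_cmod[of "w - z"] by (simp add: dist_norm)
    then have "Im w - Im z \<le> r" by simp
    then show "z \<in> upper_half" using w by (simp add: upper_half_def r_def)
  qed
  have "compact (h ` cball w r)"
    by (intro compact_continuous_image continuous_on_subset[OF holomorphic_on_imp_continuous_on[OF hol] sub]) auto
  then obtain M where M: "\<And>z. z \<in> cball w r \<Longrightarrow> cmod (h z) \<le> M"
    by (meson bounded_iff compact_imp_bounded image_eqI)
  obtain C where "0 \<le> C" and C: "\<And>y. y > 0 \<Longrightarrow> integrable lborel (\<lambda>x. (cmod ((Complex x y - w) * h (Complex x y)))\<^sup>2)"
    "\<And>y. y > 0 \<Longrightarrow> (\<integral>x. (cmod ((Complex x y - w) * h (Complex x y)))\<^sup>2 \<partial>lborel) \<le> C"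
    by (rule hardy2_upperE[OF H]) (rule that)
  let ?I = "\<lambda>x. indicator {Re w - r..Re w + r} x :: real"
  let ?u = "\<lambda>y x. (1 / r\<^sup>2) * (cmod ((Complex x y - w) * h (Complex x y)))\<^sup>2 + M\<^sup>2 * ?I x"
  show ?thesis
  proof (rule hardy2_upper_dominated[where u = ?u and C = "(1 / r\<^sup>2) * C + M\<^sup>2 * (2 * r)"])
    fix y :: real assume y: "y > 0"
    have iI: "integrable lborel ?I" and II: "(\<integral>x. ?I x \<partial>lborel) = 2 * r"
      using r by auto
    show "integrable lborel (?u y)"
      by (intro Bochner_Integration.integrable_add integrable_mult_right C y iI)
    have "(\<integral>x. ?u y x \<partial>lborel) = (1 / r\<^sup>2) * (\<integral>x. (cmod ((Complex x y - w) * h (Complex x y)))\<^sup>2 \<partial>lborel) + M\<^sup>2 * (2 * r)"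
      by (subst Bochner_Integration.integral_add)
         (use C(1)[OF y] iI II in \<open>auto simp del: integral_indicator\<close>)
    also have "\<dots> \<le> (1 / r\<^sup>2) * C + M\<^sup>2 * (2 * r)"
      by (intro add_right_mono mult_left_mono C y) auto
    finally show "(\<integral>x. ?u y x \<partial>lborel) \<le> (1 / r\<^sup>2) * C + M\<^sup>2 * (2 * r)" .
    fix x
    show "(cmod (h (Complex x y)))\<^sup>2 \<le> ?u y x"
    proof (cases "Complex x y \<in> cball w r")
      case True
      then have "\<bar>Re (w - Complex x y)\<bar> \<le> r"
        using abs_Re_le_cmod[of "w - Complex x y"] by (simp add: dist_norm)
      then have "?I x = 1" by (auto simp: indicator_def)
      moreover have "(cmod (h (Complex x y)))\<^sup>2 \<le> M\<^sup>2"
        by (intro power_mono M True) auto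
      ultimately have "(cmod (h (Complex x y)))\<^sup>2 \<le> M\<^sup>2 * ?I x" by simp
      then show ?thesis by (rule add_increasing[rotated]) simp
    next
      case False
      then have d: "r \<le> cmod (Complex x y - w)"
        by (simp add: dist_norm norm_minus_commute)
      have "r\<^sup>2 * (cmod (h (Complex x y)))\<^sup>2 \<le> (cmod ((Complex x y - w) * h (Complex x y)))\<^sup>2"
        unfolding norm_mult power_mult_distrib using d r by (intro mult_right_mono power_mono) auto
      then have "(cmod (h (Complex x y)))\<^sup>2 \<le> (1 / r\<^sup>2) * (cmod ((Complex x y - w) * h (Complex x y)))\<^sup>2"
        using r by (simp add: field_simps)
      then show ?thesis by (rule add_increasing2[rotated]) simp
    qed
  qed (rule hol)
qed

subsection \<open>Cauchy's formula in the half-plane\<close>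

text \<open>For this set \<open>holomorphic_on\<close> asks at real points only for a derivative
  within the half-plane. Since the set is convex, this is enough for Cauchy's theorem on paths that
  run along the real line.\<close>

abbreviation closed_upper_half :: "complex set" where
  "closed_upper_half \<equiv> {z. 0 \<le> Im z}"

lemma continuous_on_horizontal:
  assumes "continuous_on closed_upper_half f" "0 \<le> y"
  shows "continuous_on A (\<lambda>x. f (Complex x y))"
  by (rule continuous_on_compose2[OF assms(1)])
     (use assms(2) in \<open>auto simp: Complex_eq intro!: continuous_intros\<close>)

lemma continuous_on_vertical:
  assumes "continuous_on closed_upper_half f" "A \<subseteq> {0..}"
  shows "continuous_on A (\<lambda>y. f (Complex x y))"
  by (rule continuous_on_compose2[OF assms(1)])
     (use assms(2) in \<open>auto simp: Complex_eq intro!: continuous_intros\<close>)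

lemma horizontal_measurable:
  assumes "continuous_on closed_upper_half f" "0 \<le> y"
  shows "(\<lambda>x. f (Complex x y)) \<in> borel_measurable lborel"
  using borel_measurable_continuous_onI[OF continuous_on_horizontal[OF assms]] by simp

text \<open>Cauchy's theorem for a rectangle whose base lies on the real line, solved for the base.
  The sides are written as parameter integrals so that they can be compared with Lebesgue
  integrals.\<close>

lemma integral_rectangle:
  fixes a b Y :: real
  assumes hol: "f holomorphic_on closed_upper_half" and "a < b" "0 < Y"
  shows "integral {a..b} (\<lambda>x. f (Complex x 0)) =
     integral {a..b} (\<lambda>x. f (Complex x Y)) - \<i> * integral {0..Y} (\<lambda>y. f (Complex b y))
       + \<i> * integral {0..Y} (\<lambda>y. f (Complex a y))"
proof -
  note cont = holomorphic_on_imp_continuous_on[OF hol]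
  have conv: "convex closed_upper_half"
    by (rule convex_halfspace_Im_ge)
  have seg: "closed_segment u v \<subseteq> closed_upper_half" if "0 \<le> Im u" "0 \<le> Im v" for u v
    by (rule closed_segment_subset) (use that conv in auto)
  have cs: "continuous_on (closed_segment u v) f" if "0 \<le> Im u" "0 \<le> Im v" for u v
    by (rule continuous_on_subset[OF cont seg[OF that]])
  let ?p = "Complex a 0" and ?q = "Complex b 0" and ?r = "Complex b Y" and ?s = "Complex a Y"
  let ?ci = "\<lambda>u v. contour_integral (linepath u v) f"
  note ci = contour_integrable_continuous_linepath[OF cs]
  have z: "(f has_contour_integral 0) (linepath ?p ?q +++ linepath ?q ?r +++ linepath ?r ?s +++ linepath ?s ?p)"
  proof (rule Cauchy_theorem_convex_simple[OF hol conv])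
    show "path_image (linepath ?p ?q +++ linepath ?q ?r +++ linepath ?r ?s +++ linepath ?s ?p) \<subseteq> closed_upper_half"
      using \<open>0 < Y\<close> by (simp add: path_image_join seg)
  qed (auto intro!: valid_path_join)
  have sum: "?ci ?p ?q + (?ci ?q ?r + (?ci ?r ?s + ?ci ?s ?p)) = 0"
    using contour_integral_unique[OF z] \<open>0 < Y\<close>
    by (simp add: contour_integral_join ci)
  \<comment> \<open>A horizontal side is translated to the real axis, where a path integral is an
    integral over an interval.\<close>
  have hor: "contour_integral (linepath (Complex a y) (Complex b y)) f = integral {a..b} (\<lambda>x. f (Complex x y))" for y
  proof -
    have "contour_integral (linepath (Complex a y) (Complex b y)) f =
        contour_integral (linepath (complex_of_real a) (complex_of_real b)) (\<lambda>z. f (z + Complex 0 y))"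
      unfolding contour_integral_integral
      by (intro integral_cong arg_cong2[where f = "(*)"] arg_cong[where f = f])
         (auto simp: linepath_def complex_eq_iff algebra_simps)
    also have "\<dots> = integral {a..b} (\<lambda>x. f (Complex x y))"
      using \<open>a < b\<close> by (subst contour_integral_linepath_Reals_eq) (auto simp: Complex_eq)
    finally show ?thesis .
  qed
  have ver: "contour_integral (linepath (Complex c 0) (Complex c Y)) f = \<i> * integral {0..Y} (\<lambda>y. f (Complex c y))" for c
    by (rule contour_integral_linepath_same_Re) (use \<open>0 < Y\<close> in auto)
  have "?ci ?r ?s = - ?ci ?s ?r" "?ci ?s ?p = - ?ci ?p ?s"
    using \<open>0 < Y\<close> by (intro contour_integral_reverse_linepath cs; simp)+
  with sum show ?thesis
    by (simp add: hor ver algebra_simps add_eq_0_iff2)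
qed

text \<open>The Hardy condition controls positive heights only. Fatou's lemma along the heights
  \<open>1 / (n + 1)\<close> carries the same bound to the real line.\<close>

lemma hardy2_boundary:
  assumes cont: "continuous_on closed_upper_half F" and F: "hardy2_upper F"
  obtains C where "0 \<le> C"
    "\<And>y. 0 \<le> y \<Longrightarrow> integrable lborel (\<lambda>x. (cmod (F (Complex x y)))\<^sup>2)"
    "\<And>y. 0 \<le> y \<Longrightarrow> (\<integral>x. (cmod (F (Complex x y)))\<^sup>2 \<partial>lborel) \<le> C"
proof -
  obtain C where C0: "0 \<le> C" and C: "\<And>y. y > 0 \<Longrightarrow> integrable lborel (\<lambda>x. (cmod (F (Complex x y)))\<^sup>2)"
    "\<And>y. y > 0 \<Longrightarrow> (\<integral>x. (cmod (F (Complex x y)))\<^sup>2 \<partial>lborel) \<le> C"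
    by (rule hardy2_upperE[OF F]) (rule that)
  have lim: "(\<lambda>n. (cmod (F (Complex x (inverse (real (Suc n))))))\<^sup>2) \<longlonglongrightarrow> (cmod (F (Complex x 0)))\<^sup>2" for x
  proof -
    have "continuous_on {0..} (\<lambda>y. F (Complex x y))"
      by (rule continuous_on_vertical[OF cont]) auto
    from continuous_on_tendsto_compose[OF this LIMSEQ_inverse_real_of_nat]
    show ?thesis by (intro tendsto_intros) auto
  qed
  have meas: "(\<lambda>x. (cmod (F (Complex x 0)))\<^sup>2) \<in> borel_measurable lborel"
    using horizontal_measurable[OF cont, of 0] by measurable
  note fb = fatou_bounded[OF _ _ _ AE_I2[OF lim] meas, where C = C]
  have "integrable lborel (\<lambda>x. (cmod (F (Complex x 0)))\<^sup>2)"
    by (rule fb(1)) (rule C zero_le_power2, simp?)+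
  moreover have "(\<integral>x. (cmod (F (Complex x 0)))\<^sup>2 \<partial>lborel) \<le> C"
    by (rule fb(2)) (rule C zero_le_power2, simp?)+
  ultimately show ?thesis
    using C C0
    by (intro that[of C]) (metis order_le_less)+
qed

text \<open>A function exceeding 1 throughout a set of infinite measure would have infinite
  integral. This selects abscissas arbitrarily far out on which a vertical section is small.\<close>

lemma nn_integral_unbounded_witness:
  fixes \<phi> :: "real \<Rightarrow> ennreal"
  assumes fin: "(\<integral>\<^sup>+x. \<phi> x \<partial>lborel) < \<infinity>" and S: "S \<in> sets borel" "emeasure lborel S = \<infinity>"
  shows "\<exists>x\<in>S. \<phi> x \<le> 1"
proof (rule ccontr)
  assume "\<not> ?thesis"
  then have "indicator S x \<le> \<phi> x" for x
    by (auto simp: indicator_def not_le less_imp_le)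
  then have "(\<integral>\<^sup>+x. indicator S x \<partial>lborel) \<le> (\<integral>\<^sup>+x. \<phi> x \<partial>lborel)"
    by (intro nn_integral_mono)
  with fin S show False by (simp add: top_unique)
qed

lemma ennreal_unbounded:
  assumes "\<And>n. ennreal (real n) \<le> c"
  shows "c = \<infinity>"
proof (rule ccontr)
  assume "c \<noteq> \<infinity>"
  then obtain n where "c < of_nat n"
    using ennreal_Ex_less_of_nat[of c] by (auto simp: less_top)
  with assms[of n] show False
    by (simp add: ennreal_of_nat_eq_real_of_nat)
qed

lemma emeasure_lborel_ray:
  "emeasure lborel {t::real<..} = \<infinity>" "emeasure lborel {..<t::real} = \<infinity>"
proof -
  have "ennreal n \<le> emeasure lborel {t<..}" for n :: nat
    using emeasure_mono[of "{t<..<t + real n}" "{t<..}" lborel] by (simp add: subset_eq)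
  then show "emeasure lborel {t<..} = \<infinity>"
    by (rule ennreal_unbounded)
  have "ennreal n \<le> emeasure lborel {..<t}" for n :: nat
    using emeasure_mono[of "{t - real n<..<t}" "{..<t}" lborel] by (simp add: subset_eq)
  then show "emeasure lborel {..<t} = \<infinity>"
    by (rule ennreal_unbounded)
qed

text \<open>Fubini on the strip below height \<open>Y\<close> makes almost all of its vertical sections small,
  which provides rectangles whose vertical sides do not contribute in the limit.\<close>

lemma hardy2_small_vertical_sections:
  assumes cont: "continuous_on closed_upper_half F" and F: "hardy2_upper F"
    and S: "S \<in> sets borel" "emeasure lborel S = \<infinity>"
  shows "\<exists>x\<in>S. integral {0..Y} (\<lambda>y. (cmod (F (Complex x y)))\<^sup>2) \<le> 1"
proof -
  obtain C where C0: "0 \<le> C" and C: "\<And>y. 0 \<le> y \<Longrightarrow> integrable lborel (\<lambda>x. (cmod (F (Complex x y)))\<^sup>2)"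
    "\<And>y. 0 \<le> y \<Longrightarrow> (\<integral>x. (cmod (F (Complex x y)))\<^sup>2 \<partial>lborel) \<le> C"
    by (rule hardy2_boundary[OF cont F]) (rule that)
  \<comment> \<open>Clamping the height with \<open>max 0\<close> makes the composed function
    continuous on the whole plane, hence measurable, and changes nothing on the strip.\<close>
  let ?g = "\<lambda>(x, y). ennreal ((cmod (F (Complex x (max 0 y))))\<^sup>2) * indicator {0..Y} y"
  have "continuous_on UNIV (\<lambda>p::real \<times> real. F (Complex (fst p) (max 0 (snd p))))"
    by (rule continuous_on_compose2[OF cont]) (auto simp: Complex_eq intro!: continuous_intros)
  then have [measurable]: "(\<lambda>p::real \<times> real. F (Complex (fst p) (max 0 (snd p)))) \<in> borel_measurable (borel \<Otimes>\<^sub>M borel)"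
    unfolding borel_prod by (rule borel_measurable_continuous_onI)
  have "(\<lambda>p::real \<times> real. ennreal ((cmod (F (Complex (fst p) (max 0 (snd p)))))\<^sup>2) * indicator {0..Y} (snd p))
      \<in> borel_measurable (borel \<Otimes>\<^sub>M borel)"
    by measurable
  then have meas: "?g \<in> borel_measurable (lborel \<Otimes>\<^sub>M lborel)"
    by (simp add: case_prod_beta' cong: measurable_cong_sets)
  let ?\<phi> = "\<lambda>x. \<integral>\<^sup>+y. ?g (x, y) \<partial>lborel"
  have "(\<integral>\<^sup>+x. ?\<phi> x \<partial>lborel) = (\<integral>\<^sup>+y. (\<integral>\<^sup>+x. ?g (x, y) \<partial>lborel) \<partial>lborel)"
    by (rule lborel_pair.Fubini[OF meas, symmetric])
  also have "\<dots> \<le> (\<integral>\<^sup>+y. ennreal C * indicator {0..Y} y \<partial>lborel)"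
  proof (rule nn_integral_mono)
    fix y :: real
    show "(\<integral>\<^sup>+x. ?g (x, y) \<partial>lborel) \<le> ennreal C * indicator {0..Y} y"
      using C[of y] by (cases "y \<in> {0..Y}") (auto simp: nn_integral_eq_integral ennreal_leI)
  qed
  also have "\<dots> < \<infinity>"
    by (cases "0 \<le> Y") (auto simp: nn_integral_cmult ennreal_mult_less_top)
  finally obtain x where x: "x \<in> S" "?\<phi> x \<le> 1"
    using nn_integral_unbounded_witness[OF _ S] by blast
  let ?h = "\<lambda>y. (cmod (F (Complex x y)))\<^sup>2"
  have ch: "continuous_on {0..Y} ?h"
    by (intro continuous_intros continuous_on_vertical[OF cont]) auto
  have si: "set_integrable lborel {0..Y} ?h"
    by (rule borel_integrable_atLeastAtMost'[OF ch])
  have "ennreal (integral {0..Y} ?h) = ennreal (\<integral>y. indicator {0..Y} y *\<^sub>R ?h y \<partial>lborel)"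
    using set_borel_integral_eq_integral(2)[OF si] by (simp add: set_lebesgue_integral_def)
  also have "\<dots> = (\<integral>\<^sup>+y. ennreal (indicator {0..Y} y *\<^sub>R ?h y) \<partial>lborel)"
    using si by (intro nn_integral_eq_integral[symmetric]) (auto simp: set_integrable_def)
  also have "\<dots> = ?\<phi> x"
    by (intro nn_integral_cong) (auto simp: indicator_def)
  also have "\<dots> \<le> ennreal 1" using x by simp
  finally show ?thesis
    using x(1) by (subst (asm) ennreal_le_iff) auto
qed

text \<open>The inequality \<open>t \<le> 1 + t^2\<close> converts the bound on the square integral
  into a bound \<open>Y + 1\<close> on the integral of the modulus, and the denominator is at least
  the horizontal distance \<open>D\<close>.\<close>

lemma norm_segment_integral_le:
  fixes F :: "complex \<Rightarrow> complex"
  assumes cont: "continuous_on closed_upper_half F" and w: "Im w < 0"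
    and small: "integral {0..Y} (\<lambda>y. (cmod (F (Complex x y)))\<^sup>2) \<le> 1"
    and D: "0 < D" "D \<le> \<bar>x - Re w\<bar>" and Y: "0 < Y"
  shows "cmod (integral {0..Y} (\<lambda>y. F (Complex x y) / (Complex x y - w))) \<le> (Y + 1) / D"
proof -
  have cF: "continuous_on {0..Y} (\<lambda>y. F (Complex x y))"
    by (rule continuous_on_vertical[OF cont]) auto
  have cd: "continuous_on {0..Y} (\<lambda>y. Complex x y - w)"
    unfolding Complex_eq by (intro continuous_intros)
  have "Complex x y - w \<noteq> 0" if "0 \<le> y" for y
    using that w by (auto simp: complex_eq_iff)
  then have cq: "continuous_on {0..Y} (\<lambda>y. F (Complex x y) / (Complex x y - w))"
    by (intro continuous_on_divide cF cd) auto
  let ?h = "\<lambda>y. (cmod (F (Complex x y)))\<^sup>2"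
  have ih: "?h integrable_on {0..Y}"
    by (intro integrable_continuous_real continuous_intros cF)
  have "cmod (integral {0..Y} (\<lambda>y. F (Complex x y) / (Complex x y - w))) \<le>
      integral {0..Y} (\<lambda>y. (1 + ?h y) / D)"
  proof (rule integral_norm_bound_integral)
    show "(\<lambda>y. F (Complex x y) / (Complex x y - w)) integrable_on {0..Y}"
      by (intro integrable_continuous_real cq)
    show "(\<lambda>y. (1 + ?h y) / D) integrable_on {0..Y}"
      by (intro integrable_continuous_real continuous_intros cF) (use D in auto)
    fix y
    have "D \<le> \<bar>Re (Complex x y - w)\<bar>" using D by simp
    also have "\<dots> \<le> cmod (Complex x y - w)" by (rule abs_Re_le_cmod)
    finally have "D \<le> cmod (Complex x y - w)" .
    moreover have "t \<le> 1 + t\<^sup>2" for t :: real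
      using sum_squares_bound[of 1 t] zero_le_power2[of t] by (simp; linarith)
    ultimately show "cmod (F (Complex x y) / (Complex x y - w)) \<le> (1 + ?h y) / D"
      using D unfolding norm_divide by (intro frac_le) auto
  qed
  also have "\<dots> = (Y + integral {0..Y} ?h) / D"
    using Y by (simp add: Henstock_Kurzweil_Integration.integral_add[OF integrable_const_ivl ih])
  also have "\<dots> \<le> (Y + 1) / D"
    using small D by (intro divide_right_mono) auto
  finally show ?thesis .
qed

section \<open>Cauchy integrals of Hardy functions along the real line\<close>

lemma hardy2_Cauchy_integrable:
  assumes cont: "continuous_on closed_upper_half F" and F: "hardy2_upper F"
    and y: "0 \<le> y" and w: "y \<noteq> Im w"
  shows "integrable lborel (\<lambda>x. F (Complex x y) / (Complex x y - w))"
proof -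
  obtain C where "\<And>y. 0 \<le> y \<Longrightarrow> integrable lborel (\<lambda>x. (cmod (F (Complex x y)))\<^sup>2)"
    by (rule hardy2_boundary[OF cont F]) (rule that)
  moreover have "(\<lambda>x. 1 / (Complex x y - w)) \<in> borel_measurable lborel"
    unfolding Complex_eq by measurable
  ultimately have "integrable lborel (\<lambda>x. F (Complex x y) * (1 / (Complex x y - w)))"
    using y integral_inverse_distance_square(1)[OF w]
    by (intro integrable_mult_L2 horizontal_measurable[OF cont]) (auto simp: norm_divide power_divide)
  then show ?thesis by simp
qed

text \<open>The pole lies outside the half-plane, so the integral over the base of a rectangle
  equals that over its other three sides. The vertical sides disappear as the rectangle widens
  through well-chosen abscissas, and the top is at most \<open>sqrt (C * pi / Y)\<close>, which
  tends to zero with growing height.\<close>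

lemma hardy2_Cauchy_integral_lower:
  assumes hol: "F holomorphic_on closed_upper_half" and F: "hardy2_upper F" and w: "Im w < 0"
  shows "(\<integral>x. F (Complex x 0) / (Complex x 0 - w) \<partial>lborel) = 0"
proof -
  note cont = holomorphic_on_imp_continuous_on[OF hol]
  define \<Phi> where "\<Phi> = (\<lambda>z. F z / (z - w))"
  have hol\<Phi>: "\<Phi> holomorphic_on closed_upper_half"
    unfolding \<Phi>_def using w by (intro holomorphic_intros hol) auto
  note cont\<Phi> = holomorphic_on_imp_continuous_on[OF hol\<Phi>]
  obtain C where C0: "0 \<le> C" and C: "\<And>y. 0 \<le> y \<Longrightarrow> integrable lborel (\<lambda>x. (cmod (F (Complex x y)))\<^sup>2)"
    "\<And>y. 0 \<le> y \<Longrightarrow> (\<integral>x. (cmod (F (Complex x y)))\<^sup>2 \<partial>lborel) \<le> C"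
    by (rule hardy2_boundary[OF cont F]) (rule that)
  have i\<Phi>: "integrable lborel (\<lambda>x. \<Phi> (Complex x y))" if "0 \<le> y" for y
    unfolding \<Phi>_def using that w by (intro hardy2_Cauchy_integrable cont F) auto
  have toLeb: "integral {a..b} (\<lambda>x. \<Phi> (Complex x y)) = (\<integral>x. indicator {a..b} x *\<^sub>R \<Phi> (Complex x y) \<partial>lborel)"
    if "0 \<le> y" for a b y
  proof -
    have "set_integrable lborel {a..b} (\<lambda>x. \<Phi> (Complex x y))"
      by (intro borel_integrable_atLeastAtMost' continuous_on_horizontal cont\<Phi> that)
    from set_borel_integral_eq_integral(2)[OF this] show ?thesis
      by (simp add: set_lebesgue_integral_def)
  qed
  \<comment> \<open>Cauchy-Schwarz against the Cauchy density. The estimate does not depend on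
    \<open>a\<close> and \<open>b\<close>, so it survives the widening of the rectangle.\<close>
  have top: "cmod (integral {a..b} (\<lambda>x. \<Phi> (Complex x Y))) \<le> sqrt (C * pi / Y)" if Y: "0 < Y" for a b Y
  proof -
    have ne: "Y \<noteq> Im w" using Y w by simp
    have [measurable]: "(\<lambda>x. F (Complex x Y)) \<in> borel_measurable lborel"
      using horizontal_measurable[OF cont, of Y] Y by simp
    have [measurable]: "(\<lambda>x. Complex x Y) \<in> borel_measurable borel"
      unfolding Complex_eq by measurable
    have "cmod (integral {a..b} (\<lambda>x. \<Phi> (Complex x Y))) \<le> (\<integral>x. cmod (\<Phi> (Complex x Y)) \<partial>lborel)"
      using Y i\<Phi>[of Y]
      by (subst toLeb) (auto intro!: Bochner_Integration.integral_norm_bound_integral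
          integrable_mult_indicator split: split_indicator)
    also have "\<dots> = (\<integral>x. cmod (F (Complex x Y)) * (1 / cmod (Complex x Y - w)) \<partial>lborel)"
      by (simp add: \<Phi>_def norm_divide)
    finally have "(cmod (integral {a..b} (\<lambda>x. \<Phi> (Complex x Y))))\<^sup>2 \<le>
        (\<integral>x. cmod (F (Complex x Y)) * (1 / cmod (Complex x Y - w)) \<partial>lborel)\<^sup>2"
      by (intro power_mono) auto
    also have "\<dots> \<le> (\<integral>x. (cmod (F (Complex x Y)))\<^sup>2 \<partial>lborel) * (\<integral>x. (1 / cmod (Complex x Y - w))\<^sup>2 \<partial>lborel)"
      using Y C(1)[of Y] integral_inverse_distance_square(1)[OF ne]
      by (intro Cauchy_Schwarz_integral) (auto simp: power_divide)
    also have "\<dots> = (\<integral>x. (cmod (F (Complex x Y)))\<^sup>2 \<partial>lborel) * (pi / \<bar>Y - Im w\<bar>)"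
      using integral_inverse_distance_square(2)[OF ne] by (simp add: power_divide)
    also have "\<dots> \<le> C * (pi / Y)"
      using Y w C0 C(2)[of Y] by (intro mult_mono frac_le) auto
    finally show ?thesis by (simp add: real_le_rsqrt)
  qed
  let ?I = "\<integral>x. \<Phi> (Complex x 0) \<partial>lborel"
  \<comment> \<open>The height stays fixed while the width grows, because the bound on the vertical
    sides grows with \<open>Y\<close>.\<close>
  have bound: "cmod ?I \<le> sqrt (C * pi / Y)" if Y: "0 < Y" for Y
  proof -
    have "\<exists>b\<in>{real n<..}. integral {0..Y} (\<lambda>y. (cmod (F (Complex b y)))\<^sup>2) \<le> 1" for n
      by (intro hardy2_small_vertical_sections cont F emeasure_lborel_ray) auto
    then obtain b where b: "\<And>n. real n < b n" "\<And>n. integral {0..Y} (\<lambda>y. (cmod (F (Complex (b n) y)))\<^sup>2) \<le> 1"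
      by (metis greaterThan_iff)
    have "\<exists>a\<in>{..<- real n}. integral {0..Y} (\<lambda>y. (cmod (F (Complex a y)))\<^sup>2) \<le> 1" for n
      by (intro hardy2_small_vertical_sections cont F emeasure_lborel_ray) auto
    then obtain a where a: "\<And>n. a n < - real n" "\<And>n. integral {0..Y} (\<lambda>y. (cmod (F (Complex (a n) y)))\<^sup>2) \<le> 1"
      by (metis lessThan_iff)
    have lim: "(\<lambda>n. integral {a n..b n} (\<lambda>x. \<Phi> (Complex x 0))) \<longlonglongrightarrow> ?I"
      unfolding toLeb[OF order_refl]
    proof (rule integral_dominated_convergence[where w = "\<lambda>x. cmod (\<Phi> (Complex x 0))"])
      show "AE x in lborel. (\<lambda>n. indicator {a n..b n} x *\<^sub>R \<Phi> (Complex x 0)) \<longlonglongrightarrow> \<Phi> (Complex x 0)"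
      proof (intro AE_I2 tendsto_eventually)
        fix x :: real
        show "\<forall>\<^sub>F n in sequentially. indicator {a n..b n} x *\<^sub>R \<Phi> (Complex x 0) = \<Phi> (Complex x 0)"
          using eventually_ge_at_top[of "nat \<lceil>\<bar>x\<bar>\<rceil>"]
        proof eventually_elim
          case (elim n)
          then have "\<bar>x\<bar> \<le> real n" by linarith
          then have "x \<in> {a n..b n}" using a(1)[of n] b(1)[of n] by (auto simp: abs_le_iff)
          then show ?case by simp
        qed
      qed
    qed (use i\<Phi>[of 0] in \<open>auto simp: indicator_def\<close>)
    have ev: "\<forall>\<^sub>F n in sequentially. cmod (integral {a n..b n} (\<lambda>x. \<Phi> (Complex x 0))) \<le>
        sqrt (C * pi / Y) + 2 * ((Y + 1) / (real n - \<bar>Re w\<bar>))"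
      using eventually_gt_at_top[of "nat \<lceil>\<bar>Re w\<bar>\<rceil>"]
    proof eventually_elim
      case (elim n)
      then have D: "0 < real n - \<bar>Re w\<bar>" by linarith
      have ab: "a n < b n" using a(1)[of n] b(1)[of n] by simp
      let ?va = "integral {0..Y} (\<lambda>y. \<Phi> (Complex (a n) y))" and ?vb = "integral {0..Y} (\<lambda>y. \<Phi> (Complex (b n) y))"
      have "cmod ?va \<le> (Y + 1) / (real n - \<bar>Re w\<bar>)"
        unfolding \<Phi>_def by (rule norm_segment_integral_le[OF cont w a(2) D _ Y]) (use a(1)[of n] D in auto)
      moreover have "cmod ?vb \<le> (Y + 1) / (real n - \<bar>Re w\<bar>)"
        unfolding \<Phi>_def by (rule norm_segment_integral_le[OF cont w b(2) D _ Y]) (use b(1)[of n] D in auto)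
      moreover have "cmod (p - \<i> * q + \<i> * r) \<le> cmod p + cmod q + cmod r" for p q r
        using norm_triangle_ineq[of "p - \<i> * q" "\<i> * r"] norm_triangle_ineq4[of p "\<i> * q"]
        by (simp add: norm_mult)
      ultimately show ?case
        unfolding integral_rectangle[OF hol\<Phi> ab Y] using top[OF Y, of "a n" "b n"]
        by (smt (verit, best))
    qed
    have "(\<lambda>n. c + 2 * ((Y + 1) / (real n - \<bar>Re w\<bar>))) \<longlonglongrightarrow> c" for c
      by real_asymp
    from tendsto_le[OF _ this tendsto_norm[OF lim] ev] show ?thesis by simp
  qed
  have "(\<lambda>Y. C * pi / real Y) \<longlonglongrightarrow> 0"
    by real_asymp
  from tendsto_real_sqrt[OF this] have "(\<lambda>Y. sqrt (C * pi / real Y)) \<longlonglongrightarrow> 0"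
    by simp
  moreover have "\<forall>\<^sub>F n in sequentially. cmod ?I \<le> sqrt (C * pi / real n)"
    using eventually_gt_at_top[of 0] by eventually_elim (rule bound, simp)
  ultimately have "cmod ?I \<le> 0"
    by (intro tendsto_le[OF _ _ tendsto_const]) auto
  then show ?thesis by (simp add: \<Phi>_def)
qed

text \<open>Subtracting \<open>A / (z - cnj w)\<close>, which agrees with \<open>F\<close> at
  \<open>w\<close>, removes the pole of the integrand; the remainder integrates to zero by the
  formula for points below the line. The subtracted term is a multiple of the Cauchy density and
  yields the residue explicitly.\<close>

lemma hardy2_Cauchy_integral_upper:
  assumes hol: "F holomorphic_on closed_upper_half" and F: "hardy2_upper F" and w: "Im w > 0"
  shows "(\<integral>x. F (Complex x 0) / (Complex x 0 - w) \<partial>lborel) = 2 * pi * \<i> * F w"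
proof -
  define A where "A = F w * (2 * \<i> * Im w)"
  define N where "N = (\<lambda>z. F z - A / (z - cnj w))"
  have w2: "w - cnj w = 2 * \<i> * Im w" by (simp add: complex_eq_iff)
  have Nw: "N w = 0"
    using w by (simp add: N_def A_def w2)
  have cw: "Im (cnj w) < 0" using w by simp
  have holN: "N holomorphic_on closed_upper_half"
    unfolding N_def using w by (intro holomorphic_intros hol) auto
  have ch: "hardy2_upper (\<lambda>z. A / (z - cnj w))"
    by (rule hardy2_upper_bounded_div[OF _ cw, of _ "cmod A"]) auto
  have HN: "hardy2_upper N"
    unfolding N_def using hardy2_upper_add[OF F hardy2_upper_scale[OF ch, of "-1"]] by simp
  define \<Phi> where "\<Phi> = (\<lambda>z. if z = w then deriv N w else N z / (z - w))"
  have hol\<Phi>: "\<Phi> holomorphic_on closed_upper_half"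
  proof -
    have "w \<in> interior closed_upper_half"
      by (rule interiorI[OF open_upper_half]) (use w in \<open>auto simp: upper_half_def\<close>)
    then show ?thesis
      using pole_lemma[OF holN] unfolding \<Phi>_def by (metis (no_types, lifting) Nw diff_zero holomorphic_cong)
  qed
  have mult: "(z - w) * \<Phi> z = N z" for z
    by (simp add: \<Phi>_def Nw)
  have H\<Phi>: "hardy2_upper \<Phi>"
  proof (rule hardy2_upper_divisor[OF _ w])
    show "\<Phi> holomorphic_on upper_half"
      by (rule holomorphic_on_subset[OF hol\<Phi>]) (auto simp: upper_half_def)
  qed (simp add: mult HN)
  \<comment> \<open>The integral of \<open>\<Phi>\<close> is rewritten as the Cauchy integral of
    \<open>H\<close> at \<open>-\<i>\<close>. Multiplying by \<open>z + \<i>\<close> does not leave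
    the Hardy space here, since \<open>H\<close> equals
    \<open>N + (w + \<i>) * \<Phi>\<close>.\<close>
  define H where "H = (\<lambda>z. (z + \<i>) * \<Phi> z)"
  have "H z = N z + (w + \<i>) * \<Phi> z" for z
    by (simp add: H_def mult[symmetric] algebra_simps)
  then have HH: "hardy2_upper H"
    using hardy2_upper_add[OF HN hardy2_upper_scale[OF H\<Phi>]] by presburger
  have "(\<integral>x. H (Complex x 0) / (Complex x 0 - (-\<i>)) \<partial>lborel) = 0"
    by (rule hardy2_Cauchy_integral_lower) (auto simp: H_def intro!: holomorphic_intros hol\<Phi> HH[unfolded H_def])
  moreover have "H (Complex x 0) / (Complex x 0 - (-\<i>)) = N (Complex x 0) / (Complex x 0 - w)" for x
  proof -
    have "Complex x 0 + \<i> \<noteq> 0" "Complex x 0 \<noteq> w" using w by (auto simp: complex_eq_iff)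
    then show ?thesis by (simp add: H_def \<Phi>_def)
  qed
  ultimately have N0: "(\<integral>x. N (Complex x 0) / (Complex x 0 - w) \<partial>lborel) = 0" by simp
  have iF: "integrable lborel (\<lambda>x. F (Complex x 0) / (Complex x 0 - w))"
    by (rule hardy2_Cauchy_integrable[OF holomorphic_on_imp_continuous_on[OF hol] F]) (use w in auto)
  have ne: "0 \<noteq> Im w" using w by simp
  have id: "integrable lborel (\<lambda>x. A * of_real (1 / (cmod (Complex x 0 - w))\<^sup>2))"
    by (intro integrable_mult_right integrable_of_real integral_inverse_distance_square(1) ne)
  \<comment> \<open>For real \<open>x\<close> the product of \<open>x - w\<close> and
    \<open>x - cnj w\<close> is the squared distance from \<open>x\<close> to
    \<open>w\<close>.\<close>
  have "N (Complex x 0) / (Complex x 0 - w) =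
      F (Complex x 0) / (Complex x 0 - w) - A * of_real (1 / (cmod (Complex x 0 - w))\<^sup>2)" for x
  proof -
    have "complex_of_real ((cmod (Complex x 0 - w))\<^sup>2) = (Complex x 0 - w) * (Complex x 0 - cnj w)"
      by (subst complex_norm_square) (simp add: complex_eq_iff)
    then show ?thesis by (simp add: N_def diff_divide_distrib)
  qed
  then have "0 = (\<integral>x. F (Complex x 0) / (Complex x 0 - w) - A * of_real (1 / (cmod (Complex x 0 - w))\<^sup>2) \<partial>lborel)"
    using N0 by simp
  also have "\<dots> = (\<integral>x. F (Complex x 0) / (Complex x 0 - w) \<partial>lborel)
      - (\<integral>x. A * of_real (1 / (cmod (Complex x 0 - w))\<^sup>2) \<partial>lborel)"
    by (rule Bochner_Integration.integral_diff[OF iF id])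
  also have "(\<integral>x. A * of_real (1 / (cmod (Complex x 0 - w))\<^sup>2) \<partial>lborel) = A * of_real (pi / \<bar>0 - Im w\<bar>)"
    by (subst integral_mult_right_zero, subst integral_complex_of_real)
       (simp only: integral_inverse_distance_square(2)[OF ne])
  also have "\<dots> = 2 * pi * \<i> * F w"
    using w by (simp add: A_def)
  finally show ?thesis by simp
qed

subsection \<open>Boundary behaviour of quotients\<close>

text \<open>Near a pole \<open>|q z|\<close> is at least \<open>1 / (L * |z - x|)\<close>. On the
  segment of half-length \<open>y\<close> at height \<open>y\<close> above the pole the squared
  distance is at most \<open>2 * y^2\<close>, so the square integral is at least
  \<open>1 / (L^2 * y)\<close>, which no bound \<open>C\<close> survives as \<open>y\<close> tends
  to zero.\<close>

lemma hardy2_no_real_pole: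
  assumes q: "hardy2_upper q" and pole: "is_pole q (complex_of_real x)"
    and iso: "isolated_singularity_at q (complex_of_real x)"
  shows False
proof -
  let ?x = "complex_of_real x"
  obtain r1 where r1: "r1 > 0" "q analytic_on ball ?x r1 - {?x}"
    using iso unfolding isolated_singularity_at_def by blast
  obtain r2 where r2: "r2 > 0" "\<And>z. z \<noteq> ?x \<Longrightarrow> dist z ?x < r2 \<Longrightarrow> q z \<noteq> 0"
    using non_zero_neighbour_pole[OF pole] unfolding eventually_at by blast
  define r where "r = min r1 r2"
  have r: "r > 0" using r1 r2 by (simp add: r_def)
  have ne: "q z \<noteq> 0" if "z \<noteq> ?x" "z \<in> ball ?x r" for z
    using that r2(2)[of z] by (auto simp: r_def dist_commute)
  have "q holomorphic_on ball ?x r - {?x}"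
    using r1(2) by (intro analytic_imp_holomorphic) (auto intro: analytic_on_subset simp: r_def)
  \<comment> \<open>The reciprocal extends holomorphically by the value zero at the pole.
    Boundedness of its difference quotient \<open>?k\<close> then gives the lower bound for
    \<open>q\<close>, whatever the order of the pole.\<close>
  then have p: "(\<lambda>z. if z = ?x then 0 else inverse (q z)) holomorphic_on ball ?x r" (is "?p holomorphic_on _")
    by (rule is_pole_inverse_holomorphic[OF open_ball _ pole]) (use ne in auto)
  have k: "(\<lambda>z. if z = ?x then deriv ?p ?x else (?p z - ?p ?x) / (z - ?x)) holomorphic_on ball ?x r"
    (is "?k holomorphic_on _")
    by (rule pole_lemma[OF p]) (use r in auto)
  have "compact (?k ` cball ?x (r / 2))"
    by (intro compact_continuous_image continuous_on_subset[OF holomorphic_on_imp_continuous_on[OF k]])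
       (use r in auto)
  then obtain L0 where L0: "\<And>z. z \<in> cball ?x (r / 2) \<Longrightarrow> cmod (?k z) \<le> L0"
    by (meson bounded_iff compact_imp_bounded image_eqI)
  define L where "L = max L0 1"
  have L: "L > 0" by (simp add: L_def)
  have lower: "1 / (L * cmod (z - ?x)) \<le> cmod (q z)" if "z \<in> cball ?x (r / 2)" "z \<noteq> ?x" for z
  proof -
    have d: "0 < cmod (z - ?x)" using that(2) by simp
    have "cmod (inverse (q z) / (z - ?x)) \<le> L"
      using L0[OF that(1)] that(2) by (simp add: L_def)
    moreover have "0 < cmod (q z)" using that r ne[of z] by simp
    ultimately show ?thesis
      using d L unfolding norm_divide norm_inverse by (simp only: divide_simps mult_ac split: if_splits) auto
  qed
  obtain C where C0: "0 \<le> C" and C: "\<And>y. y > 0 \<Longrightarrow> integrable lborel (\<lambda>x. (cmod (q (Complex x y)))\<^sup>2)"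
    "\<And>y. y > 0 \<Longrightarrow> (\<integral>x. (cmod (q (Complex x y)))\<^sup>2 \<partial>lborel) \<le> C"
    by (rule hardy2_upperE[OF q]) (rule that)
  \<comment> \<open>With \<open>y \<le> r / 4\<close> the whole segment lies in the disc of radius
    \<open>r / 2\<close> on which the lower bound holds.\<close>
  have le: "1 / (L\<^sup>2 * y) \<le> C" if y: "0 < y" "y \<le> r / 4" for y
  proof -
    have "1 / (L\<^sup>2 * y) = (\<integral>t. indicator {x - y..x + y} t * (1 / (L\<^sup>2 * (2 * y\<^sup>2))) \<partial>lborel)"
      using y L by (simp add: power2_eq_square)
    also have "\<dots> \<le> (\<integral>t. (cmod (q (Complex t y)))\<^sup>2 \<partial>lborel)"
    proof (rule integral_mono[OF _ C(1)[OF y(1)]])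
      show "integrable lborel (\<lambda>t. indicator {x - y..x + y} t * (1 / (L\<^sup>2 * (2 * y\<^sup>2))))"
        using y by (intro integrable_mult_left) simp
      fix t :: real
      show "indicator {x - y..x + y} t * (1 / (L\<^sup>2 * (2 * y\<^sup>2))) \<le> (cmod (q (Complex t y)))\<^sup>2"
      proof (cases "t \<in> {x - y..x + y}")
        case True
        let ?z = "Complex t y"
        have t: "(t - x)\<^sup>2 \<le> y\<^sup>2"
          using True by (intro abs_le_square_iff[THEN iffD1]) auto
        have n2: "(cmod (?z - ?x))\<^sup>2 = (t - x)\<^sup>2 + y\<^sup>2" by (simp add: cmod_power2)
        have "?z \<noteq> ?x" using y by (auto simp: complex_eq_iff)
        moreover have "?z \<in> cball ?x (r / 2)"
        proof -
          have "(cmod (?z - ?x))\<^sup>2 \<le> (r / 2)\<^sup>2"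
            unfolding n2 using t power_mono[OF y(2), of 2] y(1) zero_le_power2[of r]
            unfolding power_divide by (simp add: power2_eq_square) (smt (verit) zero_le_square)
          then show ?thesis
            using r by (auto simp: dist_norm norm_minus_commute abs_le_square_iff[symmetric])
        qed
        ultimately have "(1 / (L * cmod (?z - ?x)))\<^sup>2 \<le> (cmod (q ?z))\<^sup>2"
          using L by (intro power_mono lower) auto
        moreover have "1 / (L\<^sup>2 * (2 * y\<^sup>2)) \<le> 1 / (L\<^sup>2 * (cmod (?z - ?x))\<^sup>2)"
          using n2 t y L by (intro divide_left_mono mult_left_mono mult_pos_pos) (auto intro: add_nonneg_pos)
        ultimately show ?thesis
          using True by (simp add: power_divide power_mult_distrib)
      qed simp
    qed
    also have "\<dots> \<le> C" by (rule C(2)[OF y(1)])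
    finally show ?thesis .
  qed
  \<comment> \<open>At this height the lower bound becomes \<open>C + 1\<close>, in conflict with
    the upper bound \<open>C\<close>.\<close>
  define y where "y = min (r / 4) (1 / (L\<^sup>2 * (C + 1)))"
  have y: "0 < y" "y \<le> r / 4" "y \<le> 1 / (L\<^sup>2 * (C + 1))"
    using r L C0 by (auto simp: y_def)
  have "L\<^sup>2 * y * (C + 1) \<le> 1"
    using y(3) L C0 by (simp add: pos_le_divide_eq add_nonneg_pos mult_ac)
  then have "C + 1 \<le> 1 / (L\<^sup>2 * y)"
    using y(1) L by (simp add: field_simps)
  with le[OF y(1,2)] show False by simp
qed

text \<open>Vertical approach through the open half-plane; it carries identities and bounds over to
  real points, where \<open>E\<close> may vanish.\<close>

lemma closed_upper_half_limit:
  assumes "continuous_on closed_upper_half F" "0 \<le> Im z"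
  shows "(\<lambda>n. F (z + \<i> * of_real (inverse (real (Suc n))))) \<longlonglongrightarrow> F z"
proof (rule continuous_on_tendsto_compose[OF assms(1)])
  have "(\<lambda>n. z + \<i> * of_real (inverse (real (Suc n)))) \<longlonglongrightarrow> z + \<i> * of_real 0"
    by (intro tendsto_intros LIMSEQ_inverse_real_of_nat)
  then show "(\<lambda>n. z + \<i> * of_real (inverse (real (Suc n)))) \<longlonglongrightarrow> z" by simp
qed (use assms(2) in auto)

text \<open>A real zero of \<open>E\<close> cannot be a pole of \<open>f / E\<close>, since the means over horizontal
  lines would blow up.\<close>

lemma hardy2_quotient_extends:
  assumes f: "f holomorphic_on UNIV" and E: "E holomorphic_on UNIV"
    and nz: "\<And>z. Im z > 0 \<Longrightarrow> E z \<noteq> 0"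
    and H: "hardy2_upper (\<lambda>z. f z / E z)"
  shows "\<exists>F. F holomorphic_on closed_upper_half \<and> (\<forall>z. 0 \<le> Im z \<longrightarrow> f z = F z * E z)"
proof -
  define q where "q = (\<lambda>z. f z / E z)"
  have an: "f analytic_on UNIV" "E analytic_on UNIV"
    using f E by (simp_all add: analytic_on_open)
  have mero: "q meromorphic_on UNIV"
    unfolding q_def by (intro meromorphic_intros analytic_on_imp_meromorphic_on an)
  \<comment> \<open>Division by zero gives \<open>q\<close> the value 0 at the real zeros of
    \<open>E\<close>; \<open>remove_sings\<close> replaces such a value by the limit of
    \<open>q\<close>.\<close>
  define F where "F = remove_sings q"
  have reg: "q analytic_on {z}" if "E z \<noteq> 0" for z
    unfolding q_def using that by (intro analytic_intros analytic_on_subset[OF an(1)] analytic_on_subset[OF an(2)]) auto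
  have ana: "F analytic_on {z}" if "0 \<le> Im z" for z
  proof (cases "E z = 0")
    case False
    then show ?thesis unfolding F_def by (intro remove_sings_analytic_on reg)
  next
    case True
    with nz[of z] that have "Im z = 0" by linarith
    then have zx: "z = complex_of_real (Re z)" by (simp add: complex_eq_iff)
    have iso: "isolated_singularity_at q z"
      using meromorphic_on_isolated_singularity mero meromorphic_on_subset by blast
    have "\<not> is_pole q z"
      using hardy2_no_real_pole[of q "Re z"] H iso zx unfolding q_def by metis
    moreover have "not_essential q z"
      using meromorphic_on_not_essential mero meromorphic_on_subset by blast
    ultimately obtain c where "q \<midarrow>z\<rightarrow> c"
      unfolding not_essential_def by blast
    then show ?thesis unfolding F_def by (rule remove_sings_analytic_at[OF iso])
  qed
  have "F analytic_on closed_upper_half"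
    using ana by (subst analytic_on_analytic_at) auto
  then have hol: "F holomorphic_on closed_upper_half"
    by (rule analytic_imp_holomorphic)
  have U: "f z = F z * E z" if "Im z > 0" for z
    using nz[OF that] reg[of z] by (simp add: F_def q_def)
  have "f z = F z * E z" if z: "0 \<le> Im z" for z
  proof -
    let ?s = "\<lambda>n. z + \<i> * of_real (inverse (real (Suc n)))"
    have "continuous_on closed_upper_half (\<lambda>z. f z - F z * E z)"
      using f E by (intro continuous_intros holomorphic_on_imp_continuous_on hol) (auto intro: holomorphic_on_subset)
    from closed_upper_half_limit[OF this z]
    have "(\<lambda>n. f (?s n) - F (?s n) * E (?s n)) \<longlonglongrightarrow> f z - F z * E z" .
    moreover have "f (?s n) - F (?s n) * E (?s n) = 0" for n
      using U[of "?s n"] z by (simp add: add_nonneg_pos)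
    ultimately have "(\<lambda>n. 0) \<longlonglongrightarrow> f z - F z * E z" by (simp only:)
    from LIMSEQ_unique[OF this tendsto_const] show ?thesis by simp
  qed
  with hol show ?thesis by blast
qed

text \<open>An entire function that is not identically zero has countably many zeros. Computations
  on the real line may therefore divide by \<open>E\<close> almost everywhere.\<close>

lemma AE_nonzero_on_reals:
  assumes "E holomorphic_on UNIV" "E z0 \<noteq> 0"
  shows "AE x in lborel. E (Complex x 0) \<noteq> 0"
proof -
  have "countable {z. E z = 0}"
  proof (cases "E constant_on UNIV")
    case True
    then have "{z. E z = 0} = {}"
      using assms(2) unfolding constant_on_def by force
    then show ?thesis by simp
  next
    case False
    from holomorphic_countable_zeros[OF assms(1) open_UNIV connected_UNIV fsigma_UNIV False]
    show ?thesis by simp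
  qed
  then have "countable (Re ` {z. E z = 0})" by simp
  moreover have "{x. E (Complex x 0) = 0} \<subseteq> Re ` {z. E z = 0}" by force
  ultimately have "countable {x. E (Complex x 0) = 0}"
    using countable_subset by blast
  then have "{x. E (Complex x 0) = 0} \<in> null_sets lborel"
    by (rule countable_imp_null_set_lborel)
  then show ?thesis
    by (auto intro: AE_I' simp: eventually_ae_filter)
qed

text \<open>This is the norm of the reproducing kernel: Cauchy's formula for
  \<open>h / (z - cnj w)\<close> at \<open>w\<close> evaluates the integral of \<open>Re h\<close>
  over the squared distance, and \<open>|h|^2\<close> is compared with \<open>2 * Re h\<close>. For
  a modulus equal to 1 on the real line there would be equality; the inequality form also covers
  lines inside the half-plane, where the modulus is smaller.\<close>

lemma kernel_integral:
  assumes hol: "\<Theta> holomorphic_on closed_upper_half"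
    and le1: "\<And>z. 0 \<le> Im z \<Longrightarrow> cmod (\<Theta> z) \<le> 1"
    and w: "Im w > 0"
  shows "integrable lborel (\<lambda>x. (cmod (1 - \<Theta> (Complex x 0) * cnj (\<Theta> w)))\<^sup>2 / (cmod (Complex x 0 - w))\<^sup>2)" (is ?int)
    and "(\<integral>x. (cmod (1 - \<Theta> (Complex x 0) * cnj (\<Theta> w)))\<^sup>2 / (cmod (Complex x 0 - w))\<^sup>2 \<partial>lborel)
          \<le> pi * (1 - (cmod (\<Theta> w))\<^sup>2) / Im w" (is ?le)
proof -
  define a where "a = \<Theta> w"
  have a1: "cmod a \<le> 1" using le1[of w] w by (simp add: a_def)
  define h where "h = (\<lambda>z. 1 - \<Theta> z * cnj a)"
  define F where "F = (\<lambda>z. h z / (z - cnj w))"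
  have holh: "h holomorphic_on closed_upper_half"
    unfolding h_def by (intro holomorphic_intros hol)
  have sub: "upper_half \<subseteq> closed_upper_half" by (auto simp: upper_half_def)
  have holF: "F holomorphic_on closed_upper_half"
    unfolding F_def using w by (intro holomorphic_intros holh) auto
  have ta: "cmod (\<Theta> z * cnj a) \<le> cmod a" if "0 \<le> Im z" for z
    using mult_right_mono[OF le1[OF that], of "cmod a"] by (simp add: norm_mult)
  have h2: "cmod (h z) \<le> 2" if "0 \<le> Im z" for z
    using norm_triangle_ineq4[of 1 "\<Theta> z * cnj a"] ta[OF that] a1 by (simp add: h_def)
  have HF: "hardy2_upper F"
    unfolding F_def
    by (rule hardy2_upper_bounded_div[where M = 2]) (use w h2 in \<open>auto intro: holomorphic_on_subset[OF holh sub]\<close>)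
  have ne: "0 \<noteq> Im w" using w by simp
  let ?d = "\<lambda>x. (cmod (Complex x 0 - w))\<^sup>2"
  have dpos: "?d x > 0" for x using w by (auto simp: complex_eq_iff)
  have split: "F (Complex x 0) / (Complex x 0 - w) = h (Complex x 0) / of_real (?d x)" for x
  proof -
    have "complex_of_real (?d x) = (Complex x 0 - w) * (Complex x 0 - cnj w)"
      by (subst complex_norm_square) (simp add: complex_eq_iff)
    then show ?thesis by (simp add: F_def mult.commute)
  qed
  have ih: "integrable lborel (\<lambda>x. h (Complex x 0) / of_real (?d x))"
    using hardy2_Cauchy_integrable[OF holomorphic_on_imp_continuous_on[OF holF] HF order_refl ne]
    by (simp add: split)
  have "(\<integral>x. h (Complex x 0) / of_real (?d x) \<partial>lborel) = 2 * pi * \<i> * F w"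
    using hardy2_Cauchy_integral_upper[OF holF HF w] by (simp add: split)
  also have "F w = (1 - a * cnj a) / (w - cnj w)"
    by (simp add: F_def h_def a_def)
  also have "\<dots> = of_real (1 - (cmod a)\<^sup>2) / (2 * \<i> * of_real (Im w))"
    by (simp add: complex_diff_cnj complex_norm_square[symmetric] mult_ac)
  also have "2 * pi * \<i> * (of_real (1 - (cmod a)\<^sup>2) / (2 * \<i> * of_real (Im w))) = of_real (pi * (1 - (cmod a)\<^sup>2) / Im w)"
    using w by (simp add: field_simps)
  finally have "Re (\<integral>x. h (Complex x 0) / of_real (?d x) \<partial>lborel) = pi * (1 - (cmod a)\<^sup>2) / Im w"
    by (metis Re_complex_of_real)
  then have val: "(\<integral>x. Re (h (Complex x 0)) / ?d x \<partial>lborel) = pi * (1 - (cmod a)\<^sup>2) / Im w"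
    by (subst (asm) integral_Re[OF ih, symmetric]) (simp add: Re_divide_of_real)
  have ir: "integrable lborel (\<lambda>x. Re (h (Complex x 0)) / ?d x)"
    using integrable_Re[OF ih] by (simp add: Re_divide_of_real)
  \<comment> \<open>Expand the square of \<open>1 - u\<close> for
    \<open>u = \<Theta> z * cnj a\<close> and use \<open>|u| \<le> |a|\<close>.\<close>
  have pw: "(cmod (h z))\<^sup>2 \<le> 2 * Re (h z) - (1 - (cmod a)\<^sup>2)" if "0 \<le> Im z" for z
  proof -
    have "(cmod (h z))\<^sup>2 = 1 - 2 * Re (\<Theta> z * cnj a) + (cmod (\<Theta> z * cnj a))\<^sup>2"
      unfolding h_def cmod_power2 by (simp add: power2_eq_square algebra_simps)
    moreover have "(cmod (\<Theta> z * cnj a))\<^sup>2 \<le> (cmod a)\<^sup>2"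
      by (intro power_mono ta that) auto
    ultimately show ?thesis by (simp add: h_def)
  qed
  note id = integral_inverse_distance_square[OF ne]
  let ?u = "\<lambda>x. 2 * (Re (h (Complex x 0)) / ?d x) - (1 - (cmod a)\<^sup>2) * (1 / ?d x)"
  have iu: "integrable lborel ?u"
    by (intro Bochner_Integration.integrable_diff integrable_mult_right ir id)
  have Iu: "(\<integral>x. ?u x \<partial>lborel) = pi * (1 - (cmod a)\<^sup>2) / Im w"
    using w by (subst Bochner_Integration.integral_diff[OF integrable_mult_right[OF ir] integrable_mult_right[OF id(1)]])
      (simp only: integral_mult_right_zero val id(2), simp add: field_simps)
  have le: "(cmod (h (Complex x 0)))\<^sup>2 / ?d x \<le> ?u x" for x
    using divide_right_mono[OF pw[of "Complex x 0"], of "?d x"] by (simp add: diff_divide_distrib)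
  have [measurable]: "(\<lambda>x. h (Complex x 0)) \<in> borel_measurable lborel"
    by (rule horizontal_measurable[OF holomorphic_on_imp_continuous_on[OF holh]]) simp
  have [measurable]: "(\<lambda>x. Complex x 0) \<in> borel_measurable borel"
    unfolding Complex_eq by measurable
  have ik: "integrable lborel (\<lambda>x. (cmod (h (Complex x 0)))\<^sup>2 / ?d x)"
  proof (rule Bochner_Integration.integrable_bound[OF iu])
    show "AE x in lborel. norm ((cmod (h (Complex x 0)))\<^sup>2 / ?d x) \<le> norm (?u x)"
      using le by (intro AE_I2) (smt (verit) real_norm_def zero_le_divide_iff zero_le_power2)
  qed measurable
  then show ?int by (simp add: h_def a_def)
  have "(\<integral>x. (cmod (h (Complex x 0)))\<^sup>2 / ?d x \<partial>lborel) \<le> (\<integral>x. ?u x \<partial>lborel)"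
    by (intro integral_mono ik iu le)
  then show ?le unfolding Iu by (simp add: h_def a_def)
qed

text \<open>Translating by \<open>\<eta>\<close> moves the line to the real axis and the kernel
  point down to \<open>w - \<i> * \<eta>\<close>, whence the denominator
  \<open>Im w - \<eta>\<close>. The Hardy bound for limits of kernels needs these estimates on every
  line.\<close>

lemma kernel_integral_shifted:
  assumes hol: "\<Theta> holomorphic_on closed_upper_half"
    and le1: "\<And>z. 0 \<le> Im z \<Longrightarrow> cmod (\<Theta> z) \<le> 1"
    and \<eta>: "0 \<le> \<eta>" "\<eta> < Im w"
  shows "integrable lborel (\<lambda>x. (cmod (1 - \<Theta> (Complex x \<eta>) * cnj (\<Theta> w)))\<^sup>2 / (cmod (Complex x \<eta> - w))\<^sup>2)"
    and "(\<integral>x. (cmod (1 - \<Theta> (Complex x \<eta>) * cnj (\<Theta> w)))\<^sup>2 / (cmod (Complex x \<eta> - w))\<^sup>2 \<partial>lborel)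
          \<le> pi * (1 - (cmod (\<Theta> w))\<^sup>2) / (Im w - \<eta>)"
proof -
  let ?T = "\<lambda>z. \<Theta> (z + Complex 0 \<eta>)"
  have hol': "?T holomorphic_on closed_upper_half"
  proof -
    have "(\<Theta> \<circ> (\<lambda>z. z + Complex 0 \<eta>)) holomorphic_on closed_upper_half"
      by (rule holomorphic_on_compose_gen[OF _ hol]) (use \<eta> in \<open>auto intro!: holomorphic_intros\<close>)
    then show ?thesis by (simp add: o_def)
  qed
  have [simp]: "Complex x 0 - (w - Complex 0 \<eta>) = Complex x \<eta> - w"
    "Complex x 0 + Complex 0 \<eta> = Complex x \<eta>" for x
    by (simp_all add: complex_eq_iff)
  note K = kernel_integral[OF hol', of "w - Complex 0 \<eta>"]
  show "integrable lborel (\<lambda>x. (cmod (1 - \<Theta> (Complex x \<eta>) * cnj (\<Theta> w)))\<^sup>2 / (cmod (Complex x \<eta> - w))\<^sup>2)"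
    using K(1) \<eta> le1 by simp
  show "(\<integral>x. (cmod (1 - \<Theta> (Complex x \<eta>) * cnj (\<Theta> w)))\<^sup>2 / (cmod (Complex x \<eta> - w))\<^sup>2 \<partial>lborel)
          \<le> pi * (1 - (cmod (\<Theta> w))\<^sup>2) / (Im w - \<eta>)"
    using K(2) \<eta> le1 by simp
qed

subsection \<open>De Branges spaces\<close>

lemma entire_linear_factor:
  fixes c :: complex
  assumes "N holomorphic_on UNIV" "N c = 0"
  obtains g where "g holomorphic_on UNIV" "\<And>z. (z - c) * g z = N z"
proof
  show "(\<lambda>z. if z = c then deriv N c else (N z - N c) / (z - c)) holomorphic_on UNIV"
    by (rule pole_lemma_open[OF assms(1) open_UNIV])
qed (simp add: assms(2))

lemma star_fun_holomorphic: "f holomorphic_on UNIV \<Longrightarrow> star_fun f holomorphic_on UNIV"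
proof -
  assume "f holomorphic_on UNIV"
  moreover have "range cnj = UNIV" by (metis surjI complex_cnj_cnj)
  ultimately show ?thesis
    using holomorphic_on_compose_cnj_cnj[of f UNIV] by (simp add: star_fun_def o_def)
qed

lemma star_fun_star_fun [simp]: "star_fun (star_fun f) = f"
  by (simp add: star_fun_def)

lemma star_fun_add: "star_fun (\<lambda>z. f z + g z) z = star_fun f z + star_fun g z"
  by (simp add: star_fun_def)

lemma star_fun_cmult: "star_fun (\<lambda>z. c * f z) z = cnj c * star_fun f z"
  by (simp add: star_fun_def)

lemma star_fun_real: "star_fun f (Complex x 0) = cnj (f (Complex x 0))"
  by (simp add: star_fun_def complex_cnj)

lemma dB_spaceD:
  assumes "f \<in> dB_space E"
  shows "f holomorphic_on UNIV" "hardy2_upper (\<lambda>z. f z / E z)" "hardy2_upper (\<lambda>z. star_fun f z / E z)"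
  using assms by (simp_all add: dB_space_def)

lemma dB_space_star: "f \<in> dB_space E \<Longrightarrow> star_fun f \<in> dB_space E"
  by (simp add: dB_space_def star_fun_holomorphic)

lemma dB_space_add:
  assumes "f \<in> dB_space E" "g \<in> dB_space E"
  shows "(\<lambda>z. f z + g z) \<in> dB_space E"
  unfolding dB_space_def mem_Collect_eq star_fun_add add_divide_distrib
  by (intro conjI holomorphic_intros hardy2_upper_add dB_spaceD[OF assms(1)] dB_spaceD[OF assms(2)])

lemma dB_space_cmult:
  assumes "f \<in> dB_space E"
  shows "(\<lambda>z. c * f z) \<in> dB_space E"
  unfolding dB_space_def mem_Collect_eq star_fun_cmult times_divide_eq_right[symmetric]
  by (intro conjI holomorphic_intros hardy2_upper_scale dB_spaceD[OF assms])

locale de_branges =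
  fixes E :: "complex \<Rightarrow> complex"
  assumes dB: "de_branges_fun E"
begin

lemma E_holomorphic: "E holomorphic_on UNIV"
  using dB by (simp add: de_branges_fun_def)

lemma star_E_less: "Im z > 0 \<Longrightarrow> cmod (star_fun E z) < cmod (E z)"
  using dB by (simp add: de_branges_fun_def)

lemma E_nonzero: "Im z > 0 \<Longrightarrow> E z \<noteq> 0"
  using star_E_less[of z] by auto

lemma E_AE_nonzero: "AE x in lborel. E (Complex x 0) \<noteq> 0"
  by (rule AE_nonzero_on_reals[OF E_holomorphic E_nonzero[of \<i>]]) simp

lemma E_holomorphic_on: "E holomorphic_on A"
  using E_holomorphic by (rule holomorphic_on_subset) simp

text \<open>The extension of \<open>f / E\<close> to the closed half-plane, whenever there is one,
  with the values at real zeros of \<open>E\<close> filled in. Below the real line, where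
  \<open>E\<close> may vanish, its values are left unspecified.\<close>

definition quot :: "(complex \<Rightarrow> complex) \<Rightarrow> complex \<Rightarrow> complex" where
  "quot f = (SOME F. F holomorphic_on closed_upper_half \<and> (\<forall>z. 0 \<le> Im z \<longrightarrow> f z = F z * E z))"

lemma quotI:
  assumes "\<exists>F. F holomorphic_on closed_upper_half \<and> (\<forall>z. 0 \<le> Im z \<longrightarrow> f z = F z * E z)"
  shows "quot f holomorphic_on closed_upper_half" "0 \<le> Im z \<Longrightarrow> f z = quot f z * E z"
  using someI_ex[OF assms] unfolding quot_def by blast+

definition Theta :: "complex \<Rightarrow> complex" where
  "Theta = quot (star_fun E)"

text \<open>The extension argument requires a Hardy quotient, but \<open>star_fun E / E\<close> is
  merely bounded. An additional factor \<open>z + \<i>\<close> in the denominator makes it square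
  integrable on lines; it is nonzero on the closed half-plane and is multiplied back
  afterwards.\<close>

lemma Theta:
  shows Theta_holomorphic: "Theta holomorphic_on closed_upper_half"
    and Theta_eq: "0 \<le> Im z \<Longrightarrow> star_fun E z = Theta z * E z"
proof -
  have "\<exists>F. F holomorphic_on closed_upper_half \<and>
      (\<forall>z. 0 \<le> Im z \<longrightarrow> star_fun E z = F z * ((z + \<i>) * E z))"
  proof (rule hardy2_quotient_extends)
    have "hardy2_upper (\<lambda>z. star_fun E z / E z / (z - (-\<i>)))"
    proof (rule hardy2_upper_bounded_div[where M = 1])
      show "(\<lambda>z. star_fun E z / E z) holomorphic_on upper_half"
        using star_fun_holomorphic[OF E_holomorphic] E_nonzero
        by (intro holomorphic_intros E_holomorphic_on) (auto simp: upper_half_def intro: holomorphic_on_subset)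
      show "cmod (star_fun E z / E z) \<le> 1" if "Im z > 0" for z
        using star_E_less[OF that] by (simp add: norm_divide divide_le_eq_1)
    qed simp
    then show "hardy2_upper (\<lambda>z. star_fun E z / ((z + \<i>) * E z))"
      by (simp add: mult.commute)
    show "(z + \<i>) * E z \<noteq> 0" if "Im z > 0" for z
    proof -
      have "z + \<i> \<noteq> 0" using that by (auto simp: complex_eq_iff)
      then show ?thesis using E_nonzero[OF that] by simp
    qed
  qed (auto intro!: holomorphic_intros E_holomorphic star_fun_holomorphic)
  then obtain F where F: "F holomorphic_on closed_upper_half"
    "\<And>z. 0 \<le> Im z \<Longrightarrow> star_fun E z = F z * ((z + \<i>) * E z)" by blast
  have "\<exists>T. T holomorphic_on closed_upper_half \<and> (\<forall>z. 0 \<le> Im z \<longrightarrow> star_fun E z = T z * E z)"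
    by (rule exI[of _ "\<lambda>z. F z * (z + \<i>)"]) (auto intro!: holomorphic_intros simp: F)
  from quotI[OF this] show "Theta holomorphic_on closed_upper_half"
    "0 \<le> Im z \<Longrightarrow> star_fun E z = Theta z * E z"
    unfolding Theta_def by blast+
qed

lemma Theta_less:
  assumes "Im z > 0"
  shows "cmod (Theta z) < 1"
proof -
  have "cmod (Theta z) * cmod (E z) < 1 * cmod (E z)"
    using star_E_less[OF assms] Theta_eq[of z] assms by (simp add: norm_mult)
  then show ?thesis by (simp only: mult_less_cancel_right) simp
qed

lemma Theta_le:
  assumes "0 \<le> Im z"
  shows "cmod (Theta z) \<le> 1"
proof (rule tendsto_upperbound)
  show "(\<lambda>n. cmod (Theta (z + \<i> * of_real (inverse (real (Suc n)))))) \<longlonglongrightarrow> cmod (Theta z)"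
    by (intro tendsto_norm closed_upper_half_limit holomorphic_on_imp_continuous_on Theta_holomorphic assms)
  show "\<forall>\<^sub>F n in sequentially. cmod (Theta (z + \<i> * of_real (inverse (real (Suc n))))) \<le> 1"
    using assms by (intro always_eventually allI less_imp_le Theta_less) (simp add: add_nonneg_pos)
qed simp

lemma Theta_real:
  assumes "E (Complex x 0) \<noteq> 0"
  shows "Theta (Complex x 0) = cnj (E (Complex x 0)) / E (Complex x 0)"
  using Theta_eq[of "Complex x 0"] assms by (simp add: star_fun_real)

section \<open>Quotients by \<open>E\<close> and their boundary values\<close>

lemma quot_dB_space:
  assumes "f \<in> dB_space E"
  shows quot_holomorphic: "quot f holomorphic_on closed_upper_half"
    and quot_eq: "0 \<le> Im z \<Longrightarrow> f z = quot f z * E z"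
    and quot_hardy2: "hardy2_upper (quot f)"
proof -
  note ex = hardy2_quotient_extends[OF dB_spaceD(1)[OF assms] E_holomorphic E_nonzero dB_spaceD(2)[OF assms]]
  show "quot f holomorphic_on closed_upper_half" "0 \<le> Im z \<Longrightarrow> f z = quot f z * E z"
    using quotI[OF ex] by blast+
  have "quot f z = f z / E z" if "Im z > 0" for z
    using quotI(2)[OF ex, of z] that E_nonzero[OF that] by simp
  then have "hardy2_upper (quot f) \<longleftrightarrow> hardy2_upper (\<lambda>z. f z / E z)"
    by (rule hardy2_upper_cong)
  with dB_spaceD(2)[OF assms] show "hardy2_upper (quot f)" by simp
qed

lemma quot_continuous: "f \<in> dB_space E \<Longrightarrow> continuous_on closed_upper_half (quot f)"
  by (rule holomorphic_on_imp_continuous_on[OF quot_holomorphic])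

lemma quot_L2:
  assumes "f \<in> dB_space E"
  shows "integrable lborel (\<lambda>x. (cmod (quot f (Complex x 0)))\<^sup>2)"
proof -
  obtain C :: real where "\<And>y. 0 \<le> y \<Longrightarrow> integrable lborel (\<lambda>x. (cmod (quot f (Complex x y)))\<^sup>2)"
    by (rule hardy2_boundary[OF quot_continuous[OF assms] quot_hardy2[OF assms]]) (rule that)
  then show ?thesis by simp
qed

lemma quot_measurable: "f \<in> dB_space E \<Longrightarrow> (\<lambda>x. quot f (Complex x 0)) \<in> borel_measurable lborel"
  by (rule horizontal_measurable[OF quot_continuous]) simp_all

lemma Theta_measurable: "(\<lambda>x. Theta (Complex x 0)) \<in> borel_measurable lborel"
  by (rule horizontal_measurable[OF holomorphic_on_imp_continuous_on[OF Theta_holomorphic]]) simp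

lemma quot_real:
  assumes "f \<in> dB_space E" "E (Complex x 0) \<noteq> 0"
  shows "quot f (Complex x 0) = f (Complex x 0) / E (Complex x 0)"
  using quot_eq[OF assms(1), of "Complex x 0"] assms(2) by simp

text \<open>On the real line \<open>\<Theta>\<close> is unimodular, so \<open>f\<^sup>* / E\<close> is the conjugate of
  \<open>(f / E)\<close> times the conjugate of \<open>\<Theta>\<close>.\<close>

lemma quot_star_real:
  assumes "f \<in> dB_space E" "E (Complex x 0) \<noteq> 0"
  shows "quot f (Complex x 0) * cnj (Theta (Complex x 0)) = cnj (quot (star_fun f) (Complex x 0))"
  using assms by (simp add: quot_real[OF dB_space_star] quot_real Theta_real star_fun_real)

lemma dB_norm2_eq:
  "dB_norm2 E f = (\<integral>x. (cmod (f (Complex x 0) / E (Complex x 0)))\<^sup>2 \<partial>lborel)"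
  by (simp add: dB_norm2_def complex_of_real_def norm_divide power_divide)

text \<open>On the real line \<open>quot f * cnj Theta\<close> is the conjugate of the quotient of
  \<open>star_fun f\<close>. That quotient is again a Hardy function, so its Cauchy integral at
  \<open>cnj w\<close> vanishes; hence the coefficient \<open>a\<close> is free. The choice
  \<open>a = Theta w\<close> gives the reproducing kernel.\<close>

lemma reproducing:
  assumes f: "f \<in> dB_space E" and w: "Im w > 0"
  shows "integrable lborel (\<lambda>x. quot f (Complex x 0) * (1 - cnj (Theta (Complex x 0)) * a) / (Complex x 0 - w))"
    and "(\<integral>x. quot f (Complex x 0) * (1 - cnj (Theta (Complex x 0)) * a) / (Complex x 0 - w) \<partial>lborel)
          = 2 * pi * \<i> * quot f w"
proof -
  let ?F = "\<lambda>x. quot f (Complex x 0)" and ?S = "\<lambda>x. quot (star_fun f) (Complex x 0)"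
  note sf = dB_space_star[OF f]
  have ne: "0 \<noteq> Im w" "0 \<noteq> Im (cnj w)" using w by auto
  have i1: "integrable lborel (\<lambda>x. ?F x / (Complex x 0 - w))"
    by (rule hardy2_Cauchy_integrable[OF quot_continuous[OF f] quot_hardy2[OF f] order_refl ne(1)])
  have i2: "integrable lborel (\<lambda>x. ?S x / (Complex x 0 - cnj w))"
    by (rule hardy2_Cauchy_integrable[OF quot_continuous[OF sf] quot_hardy2[OF sf] order_refl ne(2)])
  have z2: "(\<integral>x. ?S x / (Complex x 0 - cnj w) \<partial>lborel) = 0"
    by (rule hardy2_Cauchy_integral_lower[OF quot_holomorphic[OF sf] quot_hardy2[OF sf]]) (use w in simp)
  have cn: "cnj (?S x / (Complex x 0 - cnj w)) = cnj (?S x) / (Complex x 0 - w)" for x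
    by (simp add: complex_cnj)
  have i3: "integrable lborel (\<lambda>x. cnj (?S x) / (Complex x 0 - w))"
    using integrable_cnj[OF i2] unfolding cn .
  have z3: "(\<integral>x. cnj (?S x) / (Complex x 0 - w) \<partial>lborel) = 0"
    using Bochner_Integration.integral_cnj[of lborel "\<lambda>x. ?S x / (Complex x 0 - cnj w)"] unfolding cn z2 by simp
  let ?g = "\<lambda>x. ?F x / (Complex x 0 - w) - a * (cnj (?S x) / (Complex x 0 - w))"
  have ig: "integrable lborel ?g"
    by (intro Bochner_Integration.integrable_diff integrable_mult_right i1 i3)
  have Ig: "(\<integral>x. ?g x \<partial>lborel) = 2 * pi * \<i> * quot f w"
    by (subst Bochner_Integration.integral_diff[OF i1 integrable_mult_right[OF i3]],
        subst integral_mult_right_zero)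
       (simp add: z3 hardy2_Cauchy_integral_upper[OF quot_holomorphic[OF f] quot_hardy2[OF f] w])
  have ae: "AE x in lborel. ?g x = ?F x * (1 - cnj (Theta (Complex x 0)) * a) / (Complex x 0 - w)"
    using E_AE_nonzero
  proof eventually_elim
    case (elim x)
    show ?case
      by (simp add: quot_star_real[OF f elim, symmetric] diff_divide_distrib right_diff_distrib mult_ac)
  qed
  have m1: "(\<lambda>x. ?F x * (1 - cnj (Theta (Complex x 0)) * a) / (Complex x 0 - w)) \<in> borel_measurable lborel"
  proof -
    have [measurable]: "(\<lambda>x. Complex x 0 - w) \<in> borel_measurable borel"
      unfolding Complex_eq by measurable
    have [measurable]: "(\<lambda>x. cnj (Theta (Complex x 0))) \<in> borel_measurable lborel"
      using Theta_measurable borel_measurable_continuous_onI[of cnj] by (simp add: measurable_compose continuous_intros)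
    note [measurable] = quot_measurable[OF f]
    show ?thesis by measurable
  qed
  show "integrable lborel (\<lambda>x. ?F x * (1 - cnj (Theta (Complex x 0)) * a) / (Complex x 0 - w))"
    using integrable_cong_AE[OF borel_measurable_integrable[OF ig] m1 ae] ig by simp
  show "(\<integral>x. ?F x * (1 - cnj (Theta (Complex x 0)) * a) / (Complex x 0 - w) \<partial>lborel) = 2 * pi * \<i> * quot f w"
    using integral_cong_AE[OF borel_measurable_integrable[OF ig] m1 ae] Ig by simp
qed

text \<open>Dividing out a zero gains one power of \<open>z\<close>, because
  \<open>z * g z = N z + w * g z\<close>. In the quotient for \<open>g\<close> the factor vanishes
  inside the half-plane, in the one for \<open>star_fun g\<close> it vanishes at
  \<open>cnj w\<close> outside; these require different division lemmas.\<close>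

lemma mult_z_domain_factor:
  assumes N: "N \<in> dB_space E" and w: "Im w > 0" and Nw: "N w = 0"
  obtains g where "g \<in> mult_z_domain E" "\<And>z. (z - w) * g z = N z"
proof -
  obtain g where g: "g holomorphic_on UNIV" "\<And>z. (z - w) * g z = N z"
    by (rule entire_linear_factor[OF dB_spaceD(1)[OF N] Nw]) (rule that)
  have "hardy2_upper (\<lambda>z. g z / E z)"
  proof (rule hardy2_upper_divisor[OF _ w])
    show "(\<lambda>z. g z / E z) holomorphic_on upper_half"
      using E_nonzero by (intro holomorphic_intros holomorphic_on_subset[OF g(1)] E_holomorphic_on) (auto simp: upper_half_def)
    show "hardy2_upper (\<lambda>z. (z - w) * (g z / E z))"
      using dB_spaceD(2)[OF N] by (simp add: g(2))
  qed
  moreover have "hardy2_upper (\<lambda>z. star_fun g z / E z)"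
  proof -
    have "hardy2_upper (\<lambda>z. star_fun N z / E z / (z - cnj w))"
      by (rule hardy2_upper_div_lower[OF dB_spaceD(3)[OF N]]) (use w in simp)
    moreover have "star_fun N z / E z / (z - cnj w) = star_fun g z / E z" if "Im z > 0" for z
    proof -
      have "z \<noteq> cnj w" using that w by (auto simp: complex_eq_iff)
      moreover have "star_fun N z = (z - cnj w) * star_fun g z"
        by (simp add: star_fun_def g(2)[symmetric])
      ultimately show ?thesis by simp
    qed
    ultimately show ?thesis
      by (subst hardy2_upper_cong[symmetric, where f = "\<lambda>z. star_fun N z / E z / (z - cnj w)"]) auto
  qed
  ultimately have gd: "g \<in> dB_space E"
    using g(1) by (simp add: dB_space_def)
  have "(\<lambda>z. z * g z) = (\<lambda>z. N z + w * g z)"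
    by (simp add: g(2)[symmetric] fun_eq_iff algebra_simps)
  then have "(\<lambda>z. z * g z) \<in> dB_space E"
    using dB_space_add[OF N dB_space_cmult[OF gd]] by simp
  with gd g(2) that show thesis by (simp add: mult_z_domain_def)
qed

text \<open>Up to normalisation this is the reproducing kernel at \<open>w\<close>.\<close>

lemma kernel_function:
  assumes w: "Im w > 0"
  obtains K where "K \<in> dB_space E"
    "\<And>z. (z - cnj w) * K z = E z - cnj (Theta w) * star_fun E z"
proof -
  let ?a = "Theta w"
  have cw: "Im (cnj w) < 0" using w by simp
  let ?N = "\<lambda>z. E z - cnj ?a * star_fun E z"
  have holN: "?N holomorphic_on UNIV"
    by (intro holomorphic_intros E_holomorphic star_fun_holomorphic)
  \<comment> \<open>Conjugating \<open>star_fun E w = Theta w * E w\<close> shows that the numerator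
    vanishes at \<open>cnj w\<close>, so the quotient \<open>K\<close> is entire.\<close>
  have Nw: "?N (cnj w) = 0"
    using arg_cong[OF Theta_eq[of w], of cnj] w by (simp add: star_fun_def)
  obtain K where K: "K holomorphic_on UNIV" "\<And>z. (z - cnj w) * K z = ?N z"
    by (rule entire_linear_factor[OF holN Nw]) (rule that)
  have TU: "Theta holomorphic_on upper_half"
    by (rule holomorphic_on_subset[OF Theta_holomorphic]) (auto simp: upper_half_def)
  have nez: "z - cnj w \<noteq> 0" if "Im z > 0" for z
    using that w by (auto simp: complex_eq_iff)
  have bd: "cmod (p - q) \<le> 2" if "cmod p \<le> 1" "cmod q \<le> 1" for p q
    using norm_triangle_ineq4[of p q] that by simp
  have "hardy2_upper (\<lambda>z. K z / E z)"
  proof -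
    have "hardy2_upper (\<lambda>z. (1 - cnj ?a * Theta z) / (z - cnj w))"
    proof (rule hardy2_upper_bounded_div[OF _ cw])
      show "(\<lambda>z. 1 - cnj ?a * Theta z) holomorphic_on upper_half"
        by (intro holomorphic_intros TU)
      show "cmod (1 - cnj ?a * Theta z) \<le> 2" if "Im z > 0" for z
        using Theta_le[of z] Theta_le[of w] that w by (intro bd) (auto simp: norm_mult mult_le_one)
    qed
    moreover have "(1 - cnj ?a * Theta z) / (z - cnj w) = K z / E z" if z: "Im z > 0" for z
      using nez[OF z] E_nonzero[OF z] K(2)[of z] Theta_eq[of z] z
      by (simp add: field_simps)
    ultimately show ?thesis
      by (subst hardy2_upper_cong[symmetric, where f = "\<lambda>z. (1 - cnj ?a * Theta z) / (z - cnj w)"]) auto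
  qed
  moreover have "hardy2_upper (\<lambda>z. star_fun K z / E z)"
  proof -
    define h where "h = (\<lambda>z. star_fun K z / E z)"
    have sK: "(z - w) * star_fun K z = star_fun E z - ?a * E z" for z
      using arg_cong[OF K(2)[of "cnj z"], of cnj] by (simp add: star_fun_def)
    have mh: "(z - w) * h z = Theta z - ?a" if z: "Im z > 0" for z
      using E_nonzero[OF z] sK[of z] Theta_eq[of z] z by (simp add: h_def field_simps)
    have holh: "h holomorphic_on upper_half"
      unfolding h_def using E_nonzero
      by (intro holomorphic_intros holomorphic_on_subset[OF star_fun_holomorphic[OF K(1)]] E_holomorphic_on)
         (auto simp: upper_half_def)
    \<comment> \<open>Here \<open>h\<close> is \<open>(Theta z - Theta w) / (z - w)\<close>, whose
      removable singularity lies inside the half-plane. Division by \<open>z - cnj w\<close> gives a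
      Hardy function directly; the divisor lemma then handles \<open>h / (z - cnj w)\<close>, and
      \<open>z - cnj w = (z - w) + (w - cnj w)\<close> recovers \<open>h\<close>.\<close>
    have H0: "hardy2_upper (\<lambda>z. (Theta z - ?a) / (z - cnj w))"
    proof (rule hardy2_upper_bounded_div[OF _ cw])
      show "(\<lambda>z. Theta z - ?a) holomorphic_on upper_half"
        by (intro holomorphic_intros TU)
      show "cmod (Theta z - ?a) \<le> 2" if "Im z > 0" for z
        using Theta_le[of z] Theta_le[of w] that w by (intro bd) auto
    qed
    have H1: "hardy2_upper (\<lambda>z. h z / (z - cnj w))"
    proof (rule hardy2_upper_divisor[OF _ w])
      show "(\<lambda>z. h z / (z - cnj w)) holomorphic_on upper_half"
        using nez by (intro holomorphic_intros holh) (auto simp: upper_half_def)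
      have "hardy2_upper (\<lambda>z. (z - w) * (h z / (z - cnj w))) \<longleftrightarrow> hardy2_upper (\<lambda>z. (Theta z - ?a) / (z - cnj w))"
        by (rule hardy2_upper_cong) (simp add: mh)
      with H0 show "hardy2_upper (\<lambda>z. (z - w) * (h z / (z - cnj w)))" by simp
    qed
    have "hardy2_upper (\<lambda>z. (Theta z - ?a) / (z - cnj w) + (w - cnj w) * (h z / (z - cnj w)))"
      by (intro hardy2_upper_add H0 hardy2_upper_scale H1)
    moreover have "(Theta z - ?a) / (z - cnj w) + (w - cnj w) * (h z / (z - cnj w)) = h z" if z: "Im z > 0" for z
    proof -
      have "(Theta z - ?a) / (z - cnj w) + (w - cnj w) * (h z / (z - cnj w)) = ((z - w) * h z + (w - cnj w) * h z) / (z - cnj w)"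
        by (simp add: mh[OF z] add_divide_distrib)
      also have "(z - w) * h z + (w - cnj w) * h z = (z - cnj w) * h z"
        by (simp add: algebra_simps)
      finally show ?thesis using nez[OF z] by simp
    qed
    ultimately show ?thesis
      unfolding h_def[symmetric] by (subst hardy2_upper_cong[symmetric]) auto
  qed
  ultimately have "K \<in> dB_space E"
    using K(1) by (simp add: dB_space_def)
  with K(2) that show thesis by blast
qed

end

subsection \<open>Dense domain\<close>

lemma tail_integral_tendsto_0:
  fixes u :: "real \<Rightarrow> real"
  assumes "integrable lborel u"
  shows "(\<lambda>k. \<integral>x. indicator {x. real k < \<bar>x\<bar>} x * u x \<partial>lborel) \<longlonglongrightarrow> 0"
proof -
  have "(\<lambda>k. \<integral>x. indicator {x. real k < \<bar>x\<bar>} x * u x \<partial>lborel) \<longlonglongrightarrow> integral\<^sup>L lborel (\<lambda>x::real. 0::real)"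
  proof (rule integral_dominated_convergence[where w = "\<lambda>x. \<bar>u x\<bar>"])
    show "AE x in lborel. (\<lambda>k. indicator {x. real k < \<bar>x\<bar>} x * u x) \<longlonglongrightarrow> 0"
    proof (intro AE_I2 tendsto_eventually)
      fix x :: real
      show "\<forall>\<^sub>F k in sequentially. indicator {x. real k < \<bar>x\<bar>} x * u x = 0"
        using eventually_ge_at_top[of "nat \<lceil>\<bar>x\<bar>\<rceil>"]
      proof eventually_elim
        case (elim k)
        then have "\<bar>x\<bar> \<le> real k" by linarith
        then show ?case by simp
      qed
    qed
    show "(\<lambda>x. indicator {x. real k < \<bar>x\<bar>} x * u x) \<in> borel_measurable lborel" for k
      using assms by measurable
  qed (use assms in \<open>auto split: split_indicator\<close>)
  then show ?thesis by simp
qed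

context de_branges
begin

text \<open>Up to the factor \<open>pi / n\<close> this bounds the squared norm of the kernel at
  \<open>i n\<close>. Integer points suffice, since both directions use only a sequence of
  kernels.\<close>

definition defect :: "nat \<Rightarrow> real" where
  "defect n = 1 - (cmod (Theta (Complex 0 (real n))))\<^sup>2"

lemma defect_pos: "0 < n \<Longrightarrow> 0 < defect n"
  using Theta_less[of "Complex 0 (real n)"] by (simp add: defect_def abs_square_less_1)

text \<open>The modulus of the kernel divided by \<open>E\<close> on the real line. A real point is
  equally far from \<open>w\<close> and \<open>cnj w\<close>, so the same function also bounds the
  integrand in \<open>reproducing\<close>.\<close>

definition kernel_abs :: "nat \<Rightarrow> real \<Rightarrow> real" where
  "kernel_abs n x = cmod (1 - Theta (Complex x 0) * cnj (Theta (Complex 0 (real n))))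
     / cmod (Complex x 0 - Complex 0 (real n))"

lemma kernel_abs:
  assumes n: "0 < n"
  shows "integrable lborel (\<lambda>x. (kernel_abs n x)\<^sup>2)" "(\<integral>x. (kernel_abs n x)\<^sup>2 \<partial>lborel) \<le> pi * defect n / real n"
    "\<And>x. 0 \<le> kernel_abs n x" "\<And>x. kernel_abs n x \<le> 2 / real n" "kernel_abs n \<in> borel_measurable lborel"
proof -
  define w where "w = Complex 0 (real n)"
  have w: "Im w > 0" "Im w = real n" using n by (auto simp: w_def)
  note K = kernel_integral[OF Theta_holomorphic Theta_le w(1)]
  show "integrable lborel (\<lambda>x. (kernel_abs n x)\<^sup>2)" "(\<integral>x. (kernel_abs n x)\<^sup>2 \<partial>lborel) \<le> pi * defect n / real n"
    using K unfolding kernel_abs_def defect_def power_divide w(2) unfolding w_def by simp_all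
  show "0 \<le> kernel_abs n x" for x by (simp add: kernel_abs_def)
  show "kernel_abs n x \<le> 2 / real n" for x
    unfolding kernel_abs_def w_def[symmetric]
  proof (rule frac_le)
    have "cmod (Theta (Complex x 0) * cnj (Theta w)) \<le> 1"
      using Theta_le[of "Complex x 0"] Theta_le[of w] w by (simp add: norm_mult mult_le_one)
    then show "cmod (1 - Theta (Complex x 0) * cnj (Theta w)) \<le> 2"
      using norm_triangle_ineq4[of 1 "Theta (Complex x 0) * cnj (Theta w)"] by simp
    show "real n \<le> cmod (Complex x 0 - w)"
      using abs_Im_le_cmod[of "Complex x 0 - w"] by (simp add: w_def)
  qed (use n in auto)
  have [measurable]: "(\<lambda>x. Complex x 0 - w) \<in> borel_measurable borel"
    unfolding Complex_eq by measurable
  note [measurable] = Theta_measurable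
  show "kernel_abs n \<in> borel_measurable lborel"
    unfolding kernel_abs_def w_def[symmetric] by measurable
qed

text \<open>Up to a constant the sequence is the squared inner product of \<open>f\<close> with the
  normalised kernel. Outside \<open>[-k, k]\<close> Cauchy-Schwarz leaves the tail of
  \<open>f / E\<close>; inside, the pointwise bound \<open>2 / n\<close> on the kernel is negligible
  compared with its norm.\<close>

lemma normalised_kernels_weakly_null:
  assumes lim: "filterlim (\<lambda>n. real n * defect n) at_top sequentially"
    and f: "f \<in> dB_space E"
  shows "(\<lambda>n. real n * (cmod (quot f (Complex 0 (real n))))\<^sup>2 / defect n) \<longlonglongrightarrow> 0"
proof -
  let ?F = "\<lambda>x. cmod (quot f (Complex x 0))"
  let ?out = "\<lambda>k x. indicator {x. real k < \<bar>x\<bar>} x :: real"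
  let ?in = "\<lambda>k x. indicator {- real k..real k} x :: real"
  note L2 = quot_L2[OF f]
  note [measurable] = quot_measurable[OF f]
  define B where "B = (\<lambda>n. real n * (cmod (quot f (Complex 0 (real n))))\<^sup>2 / defect n)"
  define \<tau> where "\<tau> = (\<lambda>k. \<integral>x. (?out k x * ?F x)\<^sup>2 \<partial>lborel)"
  define c where "c = (\<lambda>k. \<integral>x. ?in k x * ?F x \<partial>lborel)"
  have sq: "(?out k x * ?F x)\<^sup>2 = ?out k x * (?F x)\<^sup>2" for k x
    by (auto split: split_indicator)
  have \<tau>0: "\<tau> \<longlonglongrightarrow> 0"
    unfolding \<tau>_def sq by (rule tail_integral_tendsto_0[OF L2])
  have iout: "integrable lborel (\<lambda>x. (?out k x * ?F x)\<^sup>2)" for k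
    by (rule Bochner_Integration.integrable_bound[OF L2]) (auto simp: sq split: split_indicator)
  have iin: "integrable lborel (\<lambda>x. ?in k x * ?F x)" for k
  proof (rule Bochner_Integration.integrable_bound)
    show "integrable lborel (\<lambda>x. ?in k x + (?F x)\<^sup>2)"
      by (intro Bochner_Integration.integrable_add L2) simp
    have "t \<le> 1 + t\<^sup>2" for t :: real
      using sum_squares_bound[of 1 t] zero_le_power2[of t] by (simp; linarith)
    then show "AE x in lborel. norm (?in k x * ?F x) \<le> norm (?in k x + (?F x)\<^sup>2)"
      by (intro AE_I2) (auto split: split_indicator)
  qed measurable
  \<comment> \<open>The two parts are separated by \<open>(a + b)^2 \<le> 2 * a^2 + 2 * b^2\<close>,
    and the result is multiplied by \<open>n / defect n\<close>.\<close>
  have bound: "4 * pi\<^sup>2 * B n \<le> 2 * pi * \<tau> k + 8 * (c k)\<^sup>2 / (real n * defect n)" if n: "0 < n" for n k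
  proof -
    define w where "w = Complex 0 (real n)"
    let ?\<kappa> = "kernel_abs n"
    note \<kappa> = kernel_abs[OF n]
    note [measurable] = \<kappa>(5)
    have w: "Im w > 0" using n by (simp add: w_def)
    note rep = reproducing[OF f w, of "Theta w"]
    have nm: "cmod (quot f (Complex x 0) * (1 - cnj (Theta (Complex x 0)) * Theta w) / (Complex x 0 - w)) = ?F x * ?\<kappa> x" for x
    proof -
      have "cmod (1 - cnj (Theta (Complex x 0)) * Theta w) = cmod (1 - Theta (Complex x 0) * cnj (Theta w))"
        by (metis complex_cnj_cnj complex_cnj_diff complex_cnj_mult complex_cnj_one complex_mod_cnj)
      then show ?thesis by (simp add: norm_mult norm_divide kernel_abs_def w_def)
    qed
    have iF: "integrable lborel (\<lambda>x. ?F x * ?\<kappa> x)"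
      using integrable_norm[OF rep(1)] by (simp only: nm)
    have le_in: "?in k x * ?F x * ?\<kappa> x \<le> ?in k x * ?F x * (2 / real n)" for x
      by (intro mult_left_mono \<kappa>(4)) auto
    have io: "integrable lborel (\<lambda>x. (?out k x * ?F x) * ?\<kappa> x)"
      by (rule Bochner_Integration.integrable_bound[OF iF]) (auto split: split_indicator simp: \<kappa>(3))
    have ii: "integrable lborel (\<lambda>x. ?in k x * ?F x * ?\<kappa> x)"
      by (rule Bochner_Integration.integrable_bound[OF iF]) (auto split: split_indicator simp: \<kappa>(3))
    have "2 * pi * cmod (quot f w) = cmod (2 * pi * \<i> * quot f w)"
      by (simp add: norm_mult)
    also have "\<dots> \<le> (\<integral>x. ?F x * ?\<kappa> x \<partial>lborel)"
      using integral_norm_bound[of lborel "\<lambda>x. quot f (Complex x 0) * (1 - cnj (Theta (Complex x 0)) * Theta w) / (Complex x 0 - w)"]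
      unfolding rep(2) nm .
    also have "\<dots> = (\<integral>x. (?out k x * ?F x) * ?\<kappa> x + ?in k x * ?F x * ?\<kappa> x \<partial>lborel)"
      by (intro Bochner_Integration.integral_cong) (auto split: split_indicator)
    also have "\<dots> = (\<integral>x. (?out k x * ?F x) * ?\<kappa> x \<partial>lborel) + (\<integral>x. ?in k x * ?F x * ?\<kappa> x \<partial>lborel)"
      by (rule Bochner_Integration.integral_add[OF io ii])
    also have "(\<integral>x. ?in k x * ?F x * ?\<kappa> x \<partial>lborel) \<le> (\<integral>x. ?in k x * ?F x * (2 / real n) \<partial>lborel)"
      by (intro integral_mono ii le_in integrable_mult_left iin)
    also have "\<dots> = c k * (2 / real n)"
      by (simp add: c_def)
    finally have le: "2 * pi * cmod (quot f w) \<le> (\<integral>x. (?out k x * ?F x) * ?\<kappa> x \<partial>lborel) + c k * (2 / real n)"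
      by simp
    let ?O = "\<integral>x. (?out k x * ?F x) * ?\<kappa> x \<partial>lborel"
    have "?O\<^sup>2 \<le> \<tau> k * (\<integral>x. (?\<kappa> x)\<^sup>2 \<partial>lborel)"
      unfolding \<tau>_def by (intro Cauchy_Schwarz_integral iout \<kappa>) auto
    also have "\<dots> \<le> \<tau> k * (pi * defect n / real n)"
      by (intro mult_left_mono \<kappa>(2)) (simp add: \<tau>_def)
    finally have O: "?O\<^sup>2 \<le> \<tau> k * (pi * defect n / real n)" .
    have "(2 * pi * cmod (quot f w))\<^sup>2 \<le> (?O + c k * (2 / real n))\<^sup>2"
      by (intro power_mono le) auto
    also have "\<dots> \<le> 2 * ?O\<^sup>2 + 2 * (c k * (2 / real n))\<^sup>2"
      using sum_squares_bound[of ?O "c k * (2 / real n)"] by (simp add: power2_sum)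
    also have "\<dots> \<le> 2 * (\<tau> k * (pi * defect n / real n)) + 2 * (c k * (2 / real n))\<^sup>2"
      using O by simp
    finally have "(2 * pi * cmod (quot f w))\<^sup>2 * (real n / defect n) \<le>
       (2 * (\<tau> k * (pi * defect n / real n)) + 2 * (c k * (2 / real n))\<^sup>2) * (real n / defect n)"
      using n defect_pos[OF n] by (intro mult_right_mono) auto
    also have "\<dots> = 2 * pi * \<tau> k + 8 * (c k)\<^sup>2 / (real n * defect n)"
      using n defect_pos[OF n] by (simp add: field_simps power2_eq_square)
    finally show ?thesis
      by (simp add: B_def w_def power_mult_distrib mult_ac)
  qed
  have Bpos: "0 \<le> B n" for n
    using defect_pos[of n] by (cases "n = 0") (auto simp: B_def)
  have "B \<longlonglongrightarrow> 0"
  proof (rule LIMSEQ_I)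
    fix \<epsilon> :: real assume e: "0 < \<epsilon>"
    have "\<forall>\<^sub>F k in sequentially. \<tau> k < \<epsilon>"
      using \<tau>0 e by (rule order_tendstoD)
    \<comment> \<open>The cut-off is fixed by the tail before \<open>n\<close> is taken large;
      \<open>c k\<close> is a constant from here on.\<close>
    then obtain k where k: "\<tau> k < \<epsilon>"
      by (meson eventually_happens sequentially_bot)
    have "\<forall>\<^sub>F n in sequentially. 8 * (c k)\<^sup>2 / \<epsilon> < real n * defect n"
      using lim by (simp add: filterlim_at_top_dense)
    then have "\<forall>\<^sub>F n in sequentially. norm (B n - 0) < \<epsilon>"
      using eventually_gt_at_top[of 0]
    proof eventually_elim
      case (elim n)
      have d: "0 < real n * defect n" using elim(2) defect_pos by simp
      have "8 * (c k)\<^sup>2 / (real n * defect n) < \<epsilon>"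
        using elim(1) e d by (simp add: pos_divide_less_eq mult.commute)
      moreover have "2 * pi * \<tau> k < 2 * pi * \<epsilon>"
        using k by simp
      ultimately have "4 * pi\<^sup>2 * B n < (2 * pi + 1) * \<epsilon>"
        using bound[OF elim(2), of k] unfolding distrib_right by linarith
      \<comment> \<open>The two error terms together are absorbed by the factor
        \<open>4 * pi^2\<close> in front of \<open>B n\<close>, so no rescaling of
        \<open>\<epsilon>\<close> is required.\<close>
      also have "(2 * pi + 1) * \<epsilon> \<le> (4 * pi\<^sup>2) * \<epsilon>"
      proof (rule mult_right_mono)
        have "pi \<ge> 2" using pi_gt3 by simp
        then have "2 * pi \<le> pi * pi" by (intro mult_right_mono) auto
        with \<open>pi \<ge> 2\<close> show "2 * pi + 1 \<le> 4 * pi\<^sup>2"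
          unfolding power2_eq_square by linarith
      qed (use e in simp)
      finally have "B n < \<epsilon>" by simp
      with Bpos[of n] show ?case by simp
    qed
    then show "\<exists>no. \<forall>n\<ge>no. norm (B n - 0) < \<epsilon>"
      by (simp add: eventually_sequentially)
  qed
  then show ?thesis by (simp add: B_def)
qed

lemma mult_z_domain_cmult: "g \<in> mult_z_domain E \<Longrightarrow> (\<lambda>z. c * g z) \<in> mult_z_domain E"
  using dB_space_cmult[of g E c] dB_space_cmult[of "\<lambda>z. z * g z" E c]
  by (simp add: mult_z_domain_def mult.left_commute)

text \<open>The approximant is \<open>w (f - c K) / (w - z)\<close> with \<open>w = i n\<close>, where \<open>K\<close> is the kernel at \<open>w\<close>
  and \<open>c\<close> is chosen to cancel the pole.\<close>

lemma domain_approximation: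
  assumes f: "f \<in> dB_space E" and n: "0 < n"
  shows "\<exists>g\<in>mult_z_domain E. dB_norm2 E (\<lambda>z. f z - g z) \<le>
    2 * (\<integral>x. (cmod (quot f (Complex x 0)))\<^sup>2 * (x\<^sup>2 / (x\<^sup>2 + (real n)\<^sup>2)) \<partial>lborel)
    + 8 * pi * (real n * (cmod (quot f (Complex 0 (real n))))\<^sup>2 / defect n)"
proof -
  define w where "w = Complex 0 (real n)"
  let ?\<kappa> = "kernel_abs n"
  note \<kappa> = kernel_abs[OF n]
  have w: "Im w > 0" using n by (simp add: w_def)
  have d: "0 < defect n" by (rule defect_pos[OF n])
  obtain K where K: "K \<in> dB_space E" "\<And>z. (z - cnj w) * K z = E z - cnj (Theta w) * star_fun E z"
    by (rule kernel_function[OF w]) (rule that)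
  have "(w - cnj w) * K w = E w * of_real (defect n)"
  proof -
    have "(w - cnj w) * K w = E w * (1 - Theta w * cnj (Theta w))"
      using K(2)[of w] Theta_eq[of w] w by (simp add: algebra_simps)
    then show ?thesis
      by (simp add: complex_norm_square[symmetric] defect_def w_def)
  qed
  moreover have "w - cnj w = 2 * \<i> * real n" by (simp add: w_def complex_eq_iff)
  ultimately have Kw: "K w = E w * of_real (defect n) / (2 * \<i> * real n)"
    using n by (simp add: field_simps)
  have Ew: "E w \<noteq> 0" by (rule E_nonzero[OF w])
  have Kw0: "K w \<noteq> 0" using Kw Ew d n by simp
  define c where "c = f w / K w"
  have cn: "cmod c = cmod (quot f w) * (2 * real n / defect n)"
    using quot_eq[OF f, of w] w Ew d n by (simp add: c_def Kw norm_mult norm_divide)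
  define N where "N = (\<lambda>z. f z + (- c) * K z)"
  have N: "N \<in> dB_space E"
    unfolding N_def by (intro dB_space_add dB_space_cmult f K)
  have Nw: "N w = 0" using Kw0 by (simp add: N_def c_def)
  obtain g where g: "g \<in> mult_z_domain E" "\<And>z. (z - w) * g z = N z"
    by (rule mult_z_domain_factor[OF N w Nw]) (rule that)
  \<comment> \<open>The sign turns the denominator \<open>z - w\<close> of \<open>g\<close> into
    \<open>w - z\<close>, so that the approximant tends to \<open>f\<close> and not to its
    negative.\<close>
  let ?g = "\<lambda>z. (- w) * g z"
  let ?F = "\<lambda>x. (cmod (quot f (Complex x 0)))\<^sup>2 * (x\<^sup>2 / (x\<^sup>2 + (real n)\<^sup>2))"
  let ?u = "\<lambda>x. 2 * ?F x + 2 * (cmod c)\<^sup>2 * (?\<kappa> x)\<^sup>2"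
  have n2: "(cmod (Complex x 0 - w))\<^sup>2 = x\<^sup>2 + (real n)\<^sup>2" for x
    by (simp add: cmod_power2 w_def)
  have pos: "0 < x\<^sup>2 + (real n)\<^sup>2" for x using n by (simp add: add_nonneg_pos)
  have iF: "integrable lborel ?F"
  proof (rule Bochner_Integration.integrable_bound[OF quot_L2[OF f]])
    show "?F \<in> borel_measurable lborel"
      using quot_measurable[OF f] by measurable
    show "AE x in lborel. norm (?F x) \<le> norm ((cmod (quot f (Complex x 0)))\<^sup>2)"
    proof (intro AE_I2)
      fix x
      have "x\<^sup>2 / (x\<^sup>2 + (real n)\<^sup>2) \<le> 1" using pos[of x] by (simp add: divide_le_eq_1)
      then have "?F x \<le> (cmod (quot f (Complex x 0)))\<^sup>2 * 1" by (intro mult_left_mono) auto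
      then show "norm (?F x) \<le> norm ((cmod (quot f (Complex x 0)))\<^sup>2)" by simp
    qed
  qed
  have iu: "integrable lborel ?u"
    by (intro Bochner_Integration.integrable_add integrable_mult_right iF \<kappa>)
  have pw: "(cmod ((f (Complex x 0) - ?g (Complex x 0)) / E (Complex x 0)))\<^sup>2 \<le> ?u x"
    if Ex: "E (Complex x 0) \<noteq> 0" for x
  proof -
    let ?z = "Complex x 0"
    have zw: "?z - w \<noteq> 0" "?z - cnj w \<noteq> 0" using n by (auto simp: w_def complex_eq_iff)
    have gz: "g ?z = (f ?z - c * K ?z) / (?z - w)"
      using g(2)[of ?z] zw by (simp add: N_def field_simps)
    have FE: "quot f ?z = f ?z / E ?z"
      by (rule quot_real[OF f Ex])
    have KE: "K ?z / E ?z = (1 - cnj (Theta w) * Theta ?z) / (?z - cnj w)"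
      using K(2)[of ?z] Theta_eq[of ?z] zw(2) Ex by (simp add: field_simps)
    have zc: "cmod (?z - cnj w) = cmod (?z - w)"
      by (simp add: cmod_def w_def)
    have nK: "cmod (K ?z / E ?z) = ?\<kappa> x"
      unfolding KE kernel_abs_def w_def[symmetric] norm_divide zc by (simp add: mult.commute)
    \<comment> \<open>The error splits into \<open>z / (z - w)\<close> times \<open>f / E\<close>,
      which is small at fixed \<open>x\<close> for large \<open>n\<close>, and a multiple of the
      kernel by \<open>w / (z - w)\<close>, whose modulus is at most 1 on the real line.\<close>
    have "(f ?z - ?g ?z) / E ?z = (f ?z * (?z - w) + w * (f ?z - c * K ?z)) / (?z - w) / E ?z"
      using zw by (simp add: gz add_divide_distrib)
    also have "f ?z * (?z - w) + w * (f ?z - c * K ?z) = ?z * f ?z - w * c * K ?z"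
      by (simp add: algebra_simps)
    also have "(?z * f ?z - w * c * K ?z) / (?z - w) / E ?z =
        ?z / (?z - w) * quot f ?z - w / (?z - w) * c * (K ?z / E ?z)"
      by (simp add: FE diff_divide_distrib mult_ac)
    finally have eq: "(f ?z - ?g ?z) / E ?z = ?z / (?z - w) * quot f ?z - w / (?z - w) * c * (K ?z / E ?z)" .
    let ?A = "?z / (?z - w) * quot f ?z" and ?B = "w / (?z - w) * c * (K ?z / E ?z)"
    have A: "(cmod ?A)\<^sup>2 = ?F x"
    proof -
      have "(cmod ?z)\<^sup>2 = x\<^sup>2" by (simp add: cmod_power2)
      then show ?thesis
        by (simp add: norm_mult norm_divide power_mult_distrib power_divide n2 mult.commute)
    qed
    have "cmod w = real n" by (simp add: w_def cmod_def)
    moreover have "real n \<le> cmod (?z - w)"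
      using abs_Im_le_cmod[of "?z - w"] by (simp add: w_def)
    ultimately have "cmod (w / (?z - w)) \<le> 1"
      using zw by (simp add: norm_divide divide_le_eq_1)
    then have "cmod ?B \<le> 1 * cmod c * ?\<kappa> x"
      unfolding norm_mult nK using \<kappa>(3)[of x] by (intro mult_right_mono) auto
    then have B: "(cmod ?B)\<^sup>2 \<le> (cmod c)\<^sup>2 * (?\<kappa> x)\<^sup>2"
      using power_mono[of "cmod ?B" "cmod c * ?\<kappa> x" 2] by (simp add: power_mult_distrib)
    have "(cmod (?A - ?B))\<^sup>2 \<le> (cmod ?A + cmod ?B)\<^sup>2"
      by (intro power_mono norm_triangle_ineq4) auto
    also have "\<dots> \<le> 2 * (cmod ?A)\<^sup>2 + 2 * (cmod ?B)\<^sup>2"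
      using sum_squares_bound[of "cmod ?A" "cmod ?B"] by (simp add: power2_sum)
    also have "\<dots> \<le> ?u x"
      using A B by simp
    finally show ?thesis unfolding eq .
  qed
  have "dB_norm2 E (\<lambda>z. f z - ?g z) \<le> (\<integral>x. ?u x \<partial>lborel)"
    unfolding dB_norm2_eq
  proof (rule integral_mono_AE'[OF iu])
    show "AE x in lborel. (cmod ((f (Complex x 0) - ?g (Complex x 0)) / E (Complex x 0)))\<^sup>2 \<le> ?u x"
      using E_AE_nonzero by eventually_elim (rule pw)
  qed auto
  also have "\<dots> = 2 * (\<integral>x. ?F x \<partial>lborel) + 2 * (cmod c)\<^sup>2 * (\<integral>x. (?\<kappa> x)\<^sup>2 \<partial>lborel)"
    by (subst Bochner_Integration.integral_add[OF integrable_mult_right[OF iF] integrable_mult_right[OF \<kappa>(1)]])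
       (simp only: integral_mult_right_zero)
  also have "\<dots> \<le> 2 * (\<integral>x. ?F x \<partial>lborel) + 2 * (cmod c)\<^sup>2 * (pi * defect n / real n)"
    by (intro add_left_mono mult_left_mono \<kappa>(2)) simp
  \<comment> \<open>Inserting \<open>|c| = 2 * n * |quot f w| / defect n\<close> produces the
    constant 8.\<close>
  also have "2 * (cmod c)\<^sup>2 * (pi * defect n / real n) = 8 * pi * (real n * (cmod (quot f w))\<^sup>2 / defect n)"
    using n d by (simp add: cn field_simps power2_eq_square)
  finally show ?thesis
    unfolding w_def by (rule bexI[OF _ mult_z_domain_cmult[OF g(1)]])
qed

lemma mult_z_densely_defined_if:
  assumes lim: "filterlim (\<lambda>n. real n * defect n) at_top sequentially"
  shows "mult_z_densely_defined E"
  unfolding mult_z_densely_defined_def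
proof (intro ballI allI impI)
  fix f and \<epsilon> :: real assume f: "f \<in> dB_space E" and e: "0 < \<epsilon>"
  let ?I = "\<lambda>n. \<integral>x. (cmod (quot f (Complex x 0)))\<^sup>2 * (x\<^sup>2 / (x\<^sup>2 + (real n)\<^sup>2)) \<partial>lborel"
  let ?B = "\<lambda>n. real n * (cmod (quot f (Complex 0 (real n))))\<^sup>2 / defect n"
  have "?I \<longlonglongrightarrow> integral\<^sup>L lborel (\<lambda>x::real. 0::real)"
  proof (rule integral_dominated_convergence[where w = "\<lambda>x. (cmod (quot f (Complex x 0)))\<^sup>2"])
    show "AE x in lborel. (\<lambda>n. (cmod (quot f (Complex x 0)))\<^sup>2 * (x\<^sup>2 / (x\<^sup>2 + (real n)\<^sup>2))) \<longlonglongrightarrow> 0"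
    proof (intro AE_I2)
      fix x :: real
      have "(\<lambda>n. c * (x\<^sup>2 / (x\<^sup>2 + (real n)\<^sup>2))) \<longlonglongrightarrow> 0" for c
        by real_asymp
      then show "(\<lambda>n. (cmod (quot f (Complex x 0)))\<^sup>2 * (x\<^sup>2 / (x\<^sup>2 + (real n)\<^sup>2))) \<longlonglongrightarrow> 0" .
    qed
    show "AE x in lborel. norm ((cmod (quot f (Complex x 0)))\<^sup>2 * (x\<^sup>2 / (x\<^sup>2 + (real n)\<^sup>2))) \<le> (cmod (quot f (Complex x 0)))\<^sup>2" for n
    proof (intro AE_I2)
      fix x :: real
      have "x\<^sup>2 / (x\<^sup>2 + (real n)\<^sup>2) \<le> 1"
        by (cases "x\<^sup>2 + (real n)\<^sup>2 > 0") (auto simp: divide_le_eq_1 not_less sum_power2_le_zero_iff)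
      then have "(cmod (quot f (Complex x 0)))\<^sup>2 * (x\<^sup>2 / (x\<^sup>2 + (real n)\<^sup>2)) \<le> (cmod (quot f (Complex x 0)))\<^sup>2 * 1"
        by (intro mult_left_mono) auto
      then show "norm ((cmod (quot f (Complex x 0)))\<^sup>2 * (x\<^sup>2 / (x\<^sup>2 + (real n)\<^sup>2))) \<le> (cmod (quot f (Complex x 0)))\<^sup>2"
        by simp
    qed
  qed (use quot_measurable[OF f] quot_L2[OF f] in \<open>auto\<close>)
  then have "(\<lambda>n. 2 * ?I n + 8 * pi * ?B n) \<longlonglongrightarrow> 2 * 0 + 8 * pi * 0"
    by (intro tendsto_intros normalised_kernels_weakly_null[OF lim f]) simp
  then have "\<forall>\<^sub>F n in sequentially. 2 * ?I n + 8 * pi * ?B n < \<epsilon>"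
    using e by (intro order_tendstoD) auto
  then have "\<forall>\<^sub>F n in sequentially. 2 * ?I n + 8 * pi * ?B n < \<epsilon> \<and> 0 < n"
    using eventually_gt_at_top[of 0] by eventually_elim simp
  then obtain n where n: "2 * ?I n + 8 * pi * ?B n < \<epsilon>" "0 < n"
    by (auto dest: eventually_happens)
  from domain_approximation[OF f n(2)] n(1)
  show "\<exists>g\<in>mult_z_domain E. dB_norm2 E (\<lambda>z. f z - g z) < \<epsilon>"
    by (meson le_less_trans)
qed

subsection \<open>Non-dense domain\<close>

text \<open>The bound forces \<open>defect n \<le> C / n\<close>, so every limit point of the values
  in the compact unit disc lies on the circle.\<close>

lemma Theta_axis_limit:
  assumes bound: "\<And>n. 0 < n \<Longrightarrow> real n * defect n \<le> C"
  obtains r c where "strict_mono r" "(\<lambda>k. Theta (Complex 0 (real (r k)))) \<longlonglongrightarrow> c" "cmod c = 1"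
proof -
  have "Theta (Complex 0 (real n)) \<in> cball 0 1" for n
    using Theta_le[of "Complex 0 (real n)"] by simp
  then obtain c r where r: "strict_mono r" and lim: "(\<lambda>k. Theta (Complex 0 (real (r k)))) \<longlonglongrightarrow> c"
    using compact_cball[of "0::complex" 1] unfolding compact_def by (fastforce simp: o_def)
  have "defect \<longlonglongrightarrow> 0"
  proof (rule tendsto_sandwich)
    show "\<forall>\<^sub>F n in sequentially. 0 \<le> defect n"
      using eventually_gt_at_top[of 0] by eventually_elim (simp add: defect_pos less_imp_le)
    show "\<forall>\<^sub>F n in sequentially. defect n \<le> C / real n"
      using eventually_gt_at_top[of 0]
    proof eventually_elim
      case (elim n)
      then show ?case using bound[of n] by (simp add: pos_le_divide_eq mult.commute)
    qed
    show "(\<lambda>n. C / real n) \<longlonglongrightarrow> 0" by real_asymp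
  qed simp
  then have "(\<lambda>k. defect (r k)) \<longlonglongrightarrow> 0"
    using LIMSEQ_subseq_LIMSEQ[OF _ r] by (fastforce simp: o_def)
  moreover have "(\<lambda>k. defect (r k)) \<longlonglongrightarrow> 1 - (cmod c)\<^sup>2"
    unfolding defect_def by (intro tendsto_intros lim)
  ultimately have "1 - (cmod c)\<^sup>2 = 0"
    by (rule LIMSEQ_unique[symmetric])
  then have "cmod c = 1"
    by (simp add: power2_eq_1_iff) (smt (verit) norm_ge_zero)
  with r lim that show thesis by blast
qed

text \<open>The rescaled kernels at \<open>i n\<close> stay bounded and converge to \<open>1 - cnj c \<Theta>\<close> along a
  subsequence.\<close>

lemma exceptional_function:
  assumes bound: "\<And>n. 0 < n \<Longrightarrow> real n * defect n \<le> C"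
  obtains c where "cmod c = 1" "(\<lambda>z. E z + (- cnj c) * star_fun E z) \<in> dB_space E"
proof -
  obtain r c where r: "strict_mono r" and lim: "(\<lambda>k. Theta (Complex 0 (real (r k)))) \<longlonglongrightarrow> c" and c: "cmod c = 1"
    by (rule Theta_axis_limit[OF bound]) (assumption, rule that)
  have TU: "Theta holomorphic_on upper_half"
    by (rule holomorphic_on_subset[OF Theta_holomorphic]) (auto simp: upper_half_def)
  let ?q = "\<lambda>z. 1 - Theta z * cnj c"
  have C0: "0 \<le> C"
    using bound[of 1] defect_pos[of 1] by simp
  have line: "integrable lborel (\<lambda>x. (cmod (?q (Complex x \<eta>)))\<^sup>2) \<and>
      (\<integral>x. (cmod (?q (Complex x \<eta>)))\<^sup>2 \<partial>lborel) \<le> 2 * pi * C" if \<eta>: "0 < \<eta>" for \<eta>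
  proof -
    \<comment> \<open>Dropping the first \<open>k0\<close> terms gives
      \<open>N k \<ge> 2 * \<eta>\<close>: the line of height \<open>\<eta>\<close> stays below the
      kernel point, and \<open>n / (n - \<eta>)\<close> is at most 2.\<close>
    define k0 where "k0 = nat \<lceil>2 * \<eta>\<rceil> + 1"
    define N where "N = (\<lambda>k. r (k + k0))"
    have Nk: "k + k0 \<le> N k" for k
      unfolding N_def by (rule strict_mono_imp_increasing[OF r])
    have N: "2 * \<eta> \<le> real (N k)" "0 < N k" for k
      using Nk[of k] unfolding k0_def by linarith+
    \<comment> \<open>The factor \<open>n^2\<close> balances the squared distance to
      \<open>i n\<close>; their ratio tends to 1 at each point of the line.\<close>
    let ?u = "\<lambda>n x. (real n)\<^sup>2 * ((cmod (1 - Theta (Complex x \<eta>) * cnj (Theta (Complex 0 (real n)))))\<^sup>2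
                 / (cmod (Complex x \<eta> - Complex 0 (real n)))\<^sup>2)"
    have Nf: "filterlim N sequentially sequentially"
      using Nk by (intro filterlim_at_top_mono[OF filterlim_ident] always_eventually allI)
        (meson add_leD1)
    have Nlim: "(\<lambda>k. Theta (Complex 0 (real (N k)))) \<longlonglongrightarrow> c"
      unfolding N_def using LIMSEQ_ignore_initial_segment[OF lim] .
    note ker = kernel_integral_shifted[OF Theta_holomorphic Theta_le less_imp_le[OF \<eta>]]
    have lt: "\<eta> < Im (Complex 0 (real (N k)))" for k
      using N[of k] \<eta> by simp
    have 1: "integrable lborel (?u (N k))" for k
      by (intro integrable_mult_right ker(1) lt)
    have 2: "(\<integral>x. ?u (N k) x \<partial>lborel) \<le> 2 * pi * C" for k
    proof -
      let ?n = "real (N k)"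
      have "(\<integral>x. ?u (N k) x \<partial>lborel) \<le> ?n\<^sup>2 * (pi * defect (N k) / (?n - \<eta>))"
        unfolding integral_mult_right_zero using ker(2)[OF _ lt[of k]]
        by (intro mult_left_mono) (auto simp: defect_def)
      also have "\<dots> = (?n * defect (N k)) * (pi * (?n / (?n - \<eta>)))"
        by (simp add: power2_eq_square)
      also have "\<dots> \<le> C * (pi * 2)"
      proof (intro mult_mono mult_left_mono bound N)
        show "?n / (?n - \<eta>) \<le> 2" using N[of k] \<eta> by (simp add: pos_divide_le_eq)
      qed (use C0 N[of k] \<eta> in auto)
      finally show ?thesis by (simp add: mult_ac)
    qed
    have 3: "AE x in lborel. (\<lambda>k. ?u (N k) x) \<longlonglongrightarrow> (cmod (?q (Complex x \<eta>)))\<^sup>2"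
    proof (intro AE_I2)
      fix x :: real
      have "(\<lambda>n. (real n)\<^sup>2 / (x\<^sup>2 + (\<eta> - real n)\<^sup>2)) \<longlonglongrightarrow> 1"
        by real_asymp
      then have "(\<lambda>k. (real (N k))\<^sup>2 / (x\<^sup>2 + (\<eta> - real (N k))\<^sup>2)) \<longlonglongrightarrow> 1"
        by (rule filterlim_compose[OF _ Nf])
      then have "(\<lambda>k. (cmod (1 - Theta (Complex x \<eta>) * cnj (Theta (Complex 0 (real (N k))))))\<^sup>2 *
           ((real (N k))\<^sup>2 / (x\<^sup>2 + (\<eta> - real (N k))\<^sup>2))) \<longlonglongrightarrow> (cmod (?q (Complex x \<eta>)))\<^sup>2 * 1"
        by (intro tendsto_intros Nlim)
      then show "(\<lambda>k. ?u (N k) x) \<longlonglongrightarrow> (cmod (?q (Complex x \<eta>)))\<^sup>2"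
        by (simp add: cmod_Complex_diff mult_ac)
    qed
    have 4: "(\<lambda>x. (cmod (?q (Complex x \<eta>)))\<^sup>2) \<in> borel_measurable lborel"
    proof -
      have [measurable]: "(\<lambda>x. Theta (Complex x \<eta>)) \<in> borel_measurable lborel"
        by (rule holomorphic_upper_half_measurable[OF TU \<eta>])
      show ?thesis by measurable
    qed
    show ?thesis
      using fatou_bounded[OF 1 _ 2 3 4] by simp
  qed
  have Hq: "hardy2_upper ?q"
    unfolding hardy2_upper_def using line by (auto intro!: holomorphic_intros TU exI[of _ "2 * pi * C"])
  let ?S = "\<lambda>z. E z + (- cnj c) * star_fun E z"
  have SU: "?S z / E z = ?q z" if "Im z > 0" for z
    using E_nonzero[OF that] Theta_eq[of z] that by (simp add: field_simps)
  have "hardy2_upper (\<lambda>z. ?S z / E z) \<longleftrightarrow> hardy2_upper ?q"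
    by (rule hardy2_upper_cong) (rule SU)
  with Hq have HS: "hardy2_upper (\<lambda>z. ?S z / E z)" by simp
  \<comment> \<open>Unimodularity of \<open>c\<close> makes \<open>star_fun\<close> of this function
    equal to \<open>- c\<close> times the function, so the second Hardy condition follows from the
    first.\<close>
  have "c * cnj c = 1"
    using c by (simp add: complex_norm_square[symmetric])
  then have "star_fun ?S z / E z = (- c) * (?S z / E z)" for z
  proof -
    have "star_fun ?S z = star_fun E z - c * E z"
      by (simp add: star_fun_def)
    also have "\<dots> = (c * cnj c) * star_fun E z - c * E z"
      using \<open>c * cnj c = 1\<close> by simp
    also have "\<dots> = (- c) * ?S z" by (simp add: algebra_simps)
    finally show ?thesis by simp
  qed
  then have "hardy2_upper (\<lambda>z. star_fun ?S z / E z)"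
    using hardy2_upper_scale[OF HS, of "- c"] by presburger
  then have "?S \<in> dB_space E"
    using HS by (auto simp: dB_space_def intro!: holomorphic_intros E_holomorphic star_fun_holomorphic)
  with c that show thesis by blast
qed

text \<open>The function \<open>(z + \<i>) * g z\<close> lies in the space as well. Dividing its
  quotient by \<open>x + \<i>\<close> returns \<open>g / E\<close>, which exhibits the integral as a
  Cauchy integral at \<open>-\<i>\<close> and provides integrability.\<close>

lemma mult_z_domain_integral:
  assumes g: "g \<in> mult_z_domain E"
  shows "integrable lborel (\<lambda>x. quot g (Complex x 0))" "(\<integral>x. quot g (Complex x 0) \<partial>lborel) = 0"
proof -
  have gd: "g \<in> dB_space E" "(\<lambda>z. z * g z) \<in> dB_space E"
    using g by (simp_all add: mult_z_domain_def)
  let ?h = "\<lambda>z. z * g z + \<i> * g z"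
  have h: "?h \<in> dB_space E"
    by (intro dB_space_add dB_space_cmult gd)
  let ?H = "\<lambda>x. quot ?h (Complex x 0) / (Complex x 0 - (- \<i>))"
  have iH: "integrable lborel ?H"
    by (rule hardy2_Cauchy_integrable[OF quot_continuous[OF h] quot_hardy2[OF h]]) auto
  have IH: "(\<integral>x. ?H x \<partial>lborel) = 0"
    by (rule hardy2_Cauchy_integral_lower[OF quot_holomorphic[OF h] quot_hardy2[OF h]]) simp
  have ae: "AE x in lborel. ?H x = quot g (Complex x 0)"
    using E_AE_nonzero
  proof eventually_elim
    case (elim x)
    have "Complex x 0 + \<i> \<noteq> 0" by (simp add: complex_eq_iff)
    moreover have "?h (Complex x 0) = (Complex x 0 + \<i>) * g (Complex x 0)"
      by (simp add: algebra_simps)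
    ultimately show ?case
      by (simp add: quot_real[OF h elim] quot_real[OF gd(1) elim])
  qed
  note cong = borel_measurable_integrable[OF iH] quot_measurable[OF gd(1)] ae
  show "integrable lborel (\<lambda>x. quot g (Complex x 0))"
    using integrable_cong_AE[OF cong] iH by simp
  show "(\<integral>x. quot g (Complex x 0) \<partial>lborel) = 0"
    using integral_cong_AE[OF cong] IH by simp
qed

lemma mult_z_domain_star:
  assumes "g \<in> mult_z_domain E"
  shows "star_fun g \<in> mult_z_domain E"
proof -
  have "(\<lambda>z. z * star_fun g z) = star_fun (\<lambda>z. z * g z)"
    by (simp add: star_fun_def)
  then show ?thesis
    using assms dB_space_star[of "\<lambda>z. z * g z"] dB_space_star[of g] by (simp add: mult_z_domain_def)
qed

text \<open>By orthogonality the squared distance from \<open>S\<close> to a domain element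
  \<open>g\<close> is the sum of the squared norms of \<open>S\<close> and \<open>g\<close>. It
  never falls below the squared norm of \<open>S\<close>, which is the \<open>\<epsilon>\<close>
  that refutes density.\<close>

lemma not_mult_z_densely_defined:
  assumes bound: "\<And>n. 0 < n \<Longrightarrow> real n * defect n \<le> C"
  shows "\<not> mult_z_densely_defined E"
proof -
  obtain c where c: "cmod c = 1" and S0: "(\<lambda>z. E z + (- cnj c) * star_fun E z) \<in> dB_space E"
    by (rule exceptional_function[OF bound]) (assumption, rule that)
  define S where "S = (\<lambda>z. E z + (- cnj c) * star_fun E z)"
  have S: "S \<in> dB_space E" using S0 by (simp add: S_def)
  let ?Q = "\<lambda>x. quot S (Complex x 0)"
  have Qreal: "?Q x = 1 - cnj c * Theta (Complex x 0)" if "E (Complex x 0) \<noteq> 0" for x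
    using quot_real[OF S that] Theta_eq[of "Complex x 0"] that by (simp add: S_def diff_divide_distrib)
  \<comment> \<open>The inner product equals the integral of \<open>g / E\<close> minus
    \<open>c\<close> times the conjugate integral for \<open>star_fun g\<close>. Both vanish because
    the domain is closed under \<open>star_fun\<close>.\<close>
  have orth: "integrable lborel (\<lambda>x. quot g (Complex x 0) * cnj (?Q x)) \<and>
      (\<integral>x. quot g (Complex x 0) * cnj (?Q x) \<partial>lborel) = 0" if g: "g \<in> mult_z_domain E" for g
  proof -
    have gd: "g \<in> dB_space E" using g by (simp add: mult_z_domain_def)
    note G = mult_z_domain_integral[OF g] mult_z_domain_integral[OF mult_z_domain_star[OF g]]
    let ?r = "\<lambda>x. quot g (Complex x 0) - c * cnj (quot (star_fun g) (Complex x 0))"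
    have ir: "integrable lborel ?r"
      by (intro Bochner_Integration.integrable_diff integrable_mult_right integrable_cnj G)
    have Ir: "(\<integral>x. ?r x \<partial>lborel) = 0"
      by (subst Bochner_Integration.integral_diff[OF G(1) integrable_mult_right[OF integrable_cnj[OF G(3)]]],
          subst integral_mult_right_zero, subst Bochner_Integration.integral_cnj) (simp add: G)
    have ae: "AE x in lborel. ?r x = quot g (Complex x 0) * cnj (?Q x)"
      using E_AE_nonzero
    proof eventually_elim
      case (elim x)
      show ?case
        by (simp add: Qreal[OF elim] quot_star_real[OF gd elim, symmetric] algebra_simps)
    qed
    have m: "(\<lambda>x. quot g (Complex x 0) * cnj (?Q x)) \<in> borel_measurable lborel"
    proof -
      have [measurable]: "cnj \<in> borel_measurable borel"
        by (intro borel_measurable_continuous_onI continuous_intros)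
      note [measurable] = quot_measurable[OF gd] quot_measurable[OF S]
      show ?thesis by measurable
    qed
    show ?thesis
      using integrable_cong_AE[OF borel_measurable_integrable[OF ir] m ae]
        integral_cong_AE[OF borel_measurable_integrable[OF ir] m ae] ir Ir by simp
  qed
  let ?\<epsilon> = "\<integral>x. (cmod (?Q x))\<^sup>2 \<partial>lborel"
  \<comment> \<open>Cauchy's formula recovers the value at \<open>\<i>\<close> from the boundary, so
    norm zero would mean \<open>S \<i> = 0\<close>, against the strict de Branges inequality at
    \<open>\<i>\<close>.\<close>
  have "?\<epsilon> \<noteq> 0"
  proof
    assume "?\<epsilon> = 0"
    then have "AE x in lborel. (cmod (?Q x))\<^sup>2 = 0"
      using integral_nonneg_eq_0_iff_AE[OF quot_L2[OF S]] by simp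
    then have "AE x in lborel. ?Q x / (Complex x 0 - \<i>) = 0"
      by eventually_elim simp
    then have "(\<integral>x. ?Q x / (Complex x 0 - \<i>) \<partial>lborel) = 0"
      by (rule integral_eq_zero_AE)
    then have "quot S \<i> = 0"
      using hardy2_Cauchy_integral_upper[OF quot_holomorphic[OF S] quot_hardy2[OF S], of \<i>] by simp
    then have "S \<i> = 0"
      using quot_eq[OF S, of \<i>] by simp
    then have "E \<i> = cnj c * star_fun E \<i>"
      by (simp add: S_def)
    then have "cmod (E \<i>) = cmod (star_fun E \<i>)"
      using c by (simp add: norm_mult)
    then show False using star_E_less[of \<i>] by simp
  qed
  moreover have "0 \<le> ?\<epsilon>" by (intro integral_nonneg_AE) auto
  ultimately have e: "0 < ?\<epsilon>" by linarith
  have far: "?\<epsilon> \<le> dB_norm2 E (\<lambda>z. S z - g z)" if g: "g \<in> mult_z_domain E" for g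
  proof -
    have gd: "g \<in> dB_space E" using g by (simp add: mult_z_domain_def)
    let ?G = "\<lambda>x. quot g (Complex x 0)"
    let ?v = "\<lambda>x. (cmod (?Q x))\<^sup>2 + (cmod (?G x))\<^sup>2 - 2 * Re (?G x * cnj (?Q x))"
    note o = orth[OF g]
    have R: "integrable lborel (\<lambda>x. Re (?G x * cnj (?Q x)))" "(\<integral>x. Re (?G x * cnj (?Q x)) \<partial>lborel) = 0"
      using o integrable_Re[of lborel "\<lambda>x. ?G x * cnj (?Q x)"] integral_Re[of lborel "\<lambda>x. ?G x * cnj (?Q x)"]
      by auto
    note iQ = quot_L2[OF S] and iG = quot_L2[OF gd]
    have iv: "integrable lborel ?v"
      by (intro Bochner_Integration.integrable_diff Bochner_Integration.integrable_add integrable_mult_right iQ iG R)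
    have "?\<epsilon> \<le> ?\<epsilon> + (\<integral>x. (cmod (?G x))\<^sup>2 \<partial>lborel)"
      by (simp add: integral_nonneg_AE)
    also have "\<dots> = (\<integral>x. ?v x \<partial>lborel)"
      by (subst Bochner_Integration.integral_diff[OF Bochner_Integration.integrable_add[OF iQ iG] integrable_mult_right[OF R(1)]],
          subst Bochner_Integration.integral_add[OF iQ iG], subst integral_mult_right_zero) (simp only: R)
    also have "\<dots> = dB_norm2 E (\<lambda>z. S z - g z)"
      unfolding dB_norm2_eq
    proof (rule integral_cong_AE)
      show ae: "AE x in lborel. ?v x = (cmod ((S (Complex x 0) - g (Complex x 0)) / E (Complex x 0)))\<^sup>2"
        using E_AE_nonzero
      proof eventually_elim
        case (elim x)
        have "(cmod (a - b))\<^sup>2 = (cmod a)\<^sup>2 + (cmod b)\<^sup>2 - 2 * Re (b * cnj a)" for a b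
          unfolding cmod_power2 by (simp add: power2_eq_square algebra_simps)
        from this[of "?Q x" "?G x"] show ?case
          by (simp add: quot_real[OF S elim] quot_real[OF gd elim] diff_divide_distrib)
      qed
      show "?v \<in> borel_measurable lborel"
        by (rule borel_measurable_integrable[OF iv])
      have cont: "continuous_on UNIV (\<lambda>x. f (Complex x 0))" if "f holomorphic_on UNIV" for f
        by (rule continuous_on_compose2[OF holomorphic_on_imp_continuous_on[OF that]])
           (auto simp: Complex_eq intro!: continuous_intros)
      note [measurable] = borel_measurable_continuous_onI[OF cont[OF dB_spaceD(1)[OF S]]]
        borel_measurable_continuous_onI[OF cont[OF dB_spaceD(1)[OF gd]]]
        borel_measurable_continuous_onI[OF cont[OF E_holomorphic]]
      show "(\<lambda>x. (cmod ((S (Complex x 0) - g (Complex x 0)) / E (Complex x 0)))\<^sup>2) \<in> borel_measurable lborel"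
        by measurable
    qed
    finally show ?thesis .
  qed
  show ?thesis
  proof
    assume "mult_z_densely_defined E"
    then obtain g where "g \<in> mult_z_domain E" "dB_norm2 E (\<lambda>z. S z - g z) < ?\<epsilon>"
      using S e unfolding mult_z_densely_defined_def by blast
    with far[of g] show False by simp
  qed
qed

end

subsection \<open>Blaschke products\<close>

definition blaschke_abs :: "complex \<Rightarrow> complex \<Rightarrow> real" where
  "blaschke_abs a z = cmod (z - a) / cmod (z - cnj a)"

text \<open>The squared distances from \<open>i n\<close> to \<open>cnj a\<close> and to
  \<open>a\<close> differ by \<open>4 * n * Im a\<close>. The resulting formula serves both
  directions: it is at most \<open>4 * Im a\<close> for every \<open>n\<close> and tends to that
  value.\<close>

lemma blaschke_abs_axis:
  assumes "Im a > 0"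
  shows "real n * (1 - (blaschke_abs a (Complex 0 (real n)))\<^sup>2) =
    4 * Im a * ((real n)\<^sup>2 / ((Re a)\<^sup>2 + (real n + Im a)\<^sup>2))"
proof -
  have "(Re a)\<^sup>2 + (real n + Im a)\<^sup>2 \<noteq> 0"
    using assms by (simp add: sum_power2_eq_zero_iff)
  then have "1 - (blaschke_abs a (Complex 0 (real n)))\<^sup>2 =
      (((Re a)\<^sup>2 + (real n + Im a)\<^sup>2) - ((Re a)\<^sup>2 + (real n - Im a)\<^sup>2)) / ((Re a)\<^sup>2 + (real n + Im a)\<^sup>2)"
    unfolding diff_divide_distrib by (simp add: blaschke_abs_def power_divide cmod_power2)
  also have "((Re a)\<^sup>2 + (real n + Im a)\<^sup>2) - ((Re a)\<^sup>2 + (real n - Im a)\<^sup>2) = 4 * Im a * real n"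
    by (simp add: power2_eq_square algebra_simps)
  finally show ?thesis by (simp add: power2_eq_square)
qed

lemma blaschke_abs_le_1:
  assumes "Im a > 0" "Im z > 0"
  shows "0 \<le> blaschke_abs a z" "blaschke_abs a z \<le> 1"
proof -
  show "0 \<le> blaschke_abs a z" by (simp add: blaschke_abs_def)
  have "(Im z - Im a)\<^sup>2 \<le> (Im z + Im a)\<^sup>2"
    using assms by (simp add: power2_eq_square algebra_simps)
  then have "cmod (z - a) \<le> cmod (z - cnj a)"
    unfolding cmod_def by simp
  then show "blaschke_abs a z \<le> 1"
    by (auto simp: blaschke_abs_def divide_le_eq_1)
qed

text \<open>The exponential factors of the Weierstrass product are real on the real line, so they have
  the same modulus at \<open>z\<close> and at its conjugate.\<close>

lemma dB_factor_cnj: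
  assumes "Im a > 0" "Im z > 0"
  shows "cmod (dB_factor a n (cnj z)) = cmod (dB_factor a n z) * blaschke_abs a z"
proof -
  have a: "a \<noteq> 0" using assms by auto
  have "1 - cnj z / cnj a = cnj ((a - z) / a)" using a by (simp add: diff_divide_distrib)
  then have 1: "cmod (1 - cnj z / cnj a) = cmod (z - a) / cmod a"
    by (metis complex_mod_cnj norm_divide norm_minus_commute)
  have "1 - z / cnj a = (cnj a - z) / cnj a" using a by (simp add: diff_divide_distrib)
  then have 2: "cmod (1 - z / cnj a) = cmod (z - cnj a) / cmod a"
    by (metis complex_mod_cnj norm_divide norm_minus_commute)
  have nz: "z - cnj a \<noteq> 0" using assms by (auto simp: complex_eq_iff)
  let ?e = "\<lambda>z. (dB_p a n z + star_fun (dB_p a n) z) / 2"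
  have "?e (cnj z) = cnj (?e z)" by (simp add: star_fun_def)
  then have 3: "cmod (exp (?e (cnj z))) = cmod (exp (?e z))"
    by (simp only: exp_cnj[symmetric] complex_mod_cnj)
  show ?thesis
    unfolding dB_factor_def norm_mult 1 2 3 blaschke_abs_def using nz by simp
qed

lemma dB_factor_nonzero:
  assumes "Im a > 0" "Im z > 0"
  shows "dB_factor a n z \<noteq> 0"
proof -
  have "z \<noteq> cnj a" "cnj a \<noteq> 0" using assms by (auto simp: complex_eq_iff)
  then show ?thesis by (simp add: dB_factor_def)
qed

text \<open>Compare \<open>E\<close> at \<open>z\<close> and \<open>cnj z\<close>: \<open>G\<close>
  has equal moduli there, the exponential contributes \<open>exp (- 2 * \<sigma> * Im z)\<close>,
  and each factor of the product contributes its Blaschke modulus.\<close>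

lemma blaschke_product_limit:
  assumes zs_upper: "\<And>m. Im (zs m) > 0"
    and prod_conv: "\<And>z. convergent_prod (\<lambda>m. dB_factor (zs m) (Suc m) z)"
    and repr: "\<And>z. E z = \<gamma> * G z * exp (- \<i> * of_real \<sigma> * z) * (\<Prod>m. dB_factor (zs m) (Suc m) z)"
    and gamma: "cmod \<gamma> = 1" and G_real: "star_fun G = G"
    and z: "Im z > 0" and Ez: "E z \<noteq> 0"
  shows "(\<lambda>N. \<Prod>m\<le>N. blaschke_abs (zs m) z) \<longlonglongrightarrow> exp (2 * \<sigma> * Im z) * (cmod (star_fun E z) / cmod (E z))"
proof -
  let ?f = "\<lambda>m z. dB_factor (zs m) (Suc m) z"
  let ?P = "\<lambda>z. \<Prod>m. ?f m z"
  have Gz: "cmod (G (cnj z)) = cmod (G z)"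
    using fun_cong[OF G_real, of z] by (metis complex_mod_cnj star_fun_def)
  have Ecm: "cmod (E u) = cmod (G u) * exp (\<sigma> * Im u) * cmod (?P u)" for u
    by (subst repr) (simp add: norm_mult gamma)
  have lim: "(\<lambda>N. \<Prod>m\<le>N. cmod (?f m u)) \<longlonglongrightarrow> cmod (?P u)" for u
    unfolding prod_norm by (intro tendsto_norm convergent_prod_LIMSEQ prod_conv)
  have P0: "cmod (?P z) \<noteq> 0" "cmod (G z) \<noteq> 0"
    using Ez Ecm[of z] by auto
  have "(\<lambda>N. (\<Prod>m\<le>N. cmod (?f m (cnj z))) / (\<Prod>m\<le>N. cmod (?f m z))) \<longlonglongrightarrow> cmod (?P (cnj z)) / cmod (?P z)"
    by (intro tendsto_divide lim P0)
  moreover have "(\<Prod>m\<le>N. cmod (?f m (cnj z))) / (\<Prod>m\<le>N. cmod (?f m z)) = (\<Prod>m\<le>N. blaschke_abs (zs m) z)" for N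
    using dB_factor_nonzero[OF zs_upper z]
    by (simp add: dB_factor_cnj[OF zs_upper z] prod_dividef[symmetric])
  moreover have "cmod (?P (cnj z)) / cmod (?P z) = exp (2 * \<sigma> * Im z) * (cmod (star_fun E z) / cmod (E z))"
  proof -
    have "cmod (star_fun E z) = cmod (G z) * exp (- (\<sigma> * Im z)) * cmod (?P (cnj z))"
      using Ecm[of "cnj z"] by (simp add: star_fun_def Gz)
    moreover have "exp (2 * \<sigma> * Im z) * exp (- (\<sigma> * Im z)) = exp (\<sigma> * Im z)"
      by (simp add: exp_add[symmetric] algebra_simps)
    ultimately show ?thesis
      unfolding Ecm[of z] using P0 by (simp add: field_simps)
  qed
  ultimately show ?thesis by simp
qed

text \<open>Induction on \<open>1 - P * b = (1 - P) + P * (1 - b)\<close>; convergence of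
  \<open>n * (1 - P)\<close> already forces \<open>P\<close> to tend to 1.\<close>

lemma blaschke_defect_limit:
  fixes zs :: "nat \<Rightarrow> complex"
  assumes "\<And>m. Im (zs m) > 0"
  shows "(\<lambda>n. real n * (1 - (\<Prod>m<N. (blaschke_abs (zs m) (Complex 0 (real n)))\<^sup>2))) \<longlonglongrightarrow> 4 * (\<Sum>m<N. Im (zs m))"
proof (induction N)
  case 0
  show ?case by simp
next
  case (Suc N)
  let ?b = "\<lambda>m n. (blaschke_abs (zs m) (Complex 0 (real n)))\<^sup>2"
  let ?P = "\<lambda>n. \<Prod>m<N. ?b m n"
  have "(\<lambda>n. 1 - inverse (real n) * (real n * (1 - ?P n))) \<longlonglongrightarrow> 1 - 0 * (4 * (\<Sum>m<N. Im (zs m)))"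
    by (intro tendsto_intros Suc.IH lim_inverse_n)
  moreover have "\<forall>\<^sub>F n in sequentially. 1 - inverse (real n) * (real n * (1 - ?P n)) = ?P n"
    using eventually_gt_at_top[of 0] by eventually_elim (simp add: mult.assoc[symmetric])
  ultimately have P: "?P \<longlonglongrightarrow> 1"
    by (subst (asm) tendsto_cong) auto
  have b: "(\<lambda>n. real n * (1 - ?b N n)) \<longlonglongrightarrow> 4 * Im (zs N)"
  proof -
    have y: "0 < Im (zs N)" by (rule assms)
    have "(\<lambda>n. 4 * y * ((real n)\<^sup>2 / (x\<^sup>2 + (real n + y)\<^sup>2))) \<longlonglongrightarrow> 4 * y" if "0 < y" for x y :: real
      using that by real_asymp
    from this[OF y] show ?thesis unfolding blaschke_abs_axis[OF y] .
  qed
  have "(\<lambda>n. real n * (1 - ?P n) + ?P n * (real n * (1 - ?b N n))) \<longlonglongrightarrow>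
      4 * (\<Sum>m<N. Im (zs m)) + 1 * (4 * Im (zs N))"
    by (intro tendsto_intros Suc.IH P b)
  then show ?case
    by (simp add: algebra_simps)
qed

section \<open>Growth of \<open>n * defect n\<close> in terms of \<open>\<sigma>\<close> and the
  zeros\<close>

theorem theorem11:
  fixes E G :: "complex \<Rightarrow> complex" and \<gamma> :: complex and \<sigma> :: real
    and zs :: "nat \<Rightarrow> complex"  \<comment> \<open>zs m is z_{m+1}\<close>
  assumes dB: "de_branges_fun E"
    and zs_upper: "\<forall>m. Im (zs m) > 0"
    and zeros: "\<forall>w. Im w < 0 \<longrightarrow> (E w = 0 \<longleftrightarrow> (\<exists>m. w = cnj (zs m)))"
    and ordered: "\<forall>m. cmod (zs m) \<le> cmod (zs (Suc m))"
    and summ: "summable (\<lambda>m. \<bar>Im (1 / zs m)\<bar>)"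
    and sigma: "\<sigma> \<ge> 0"
    and gamma: "cmod \<gamma> = 1"
    and G_entire: "G holomorphic_on UNIV"
    and G_real: "star_fun G = G"
    and G_zeros: "\<forall>z. G z = 0 \<longrightarrow> Im z = 0"
    and prod_conv: "\<forall>z. convergent_prod (\<lambda>m. dB_factor (zs m) (Suc m) z)"
    and repr: "\<forall>z. E z = \<gamma> * G z * exp (- \<i> * of_real \<sigma> * z)
                          * (\<Prod>m. dB_factor (zs m) (Suc m) z)"
  shows "mult_z_densely_defined E \<longleftrightarrow> (\<sigma> > 0 \<or> \<not> summable (\<lambda>m. Im (zs m)))"
proof -
  interpret de_branges E by unfold_locales (rule dB)
  let ?b = "\<lambda>m n. blaschke_abs (zs m) (Complex 0 (real n))"
  have y: "Im (zs m) > 0" for m using zs_upper by simp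
  have b01: "0 \<le> ?b m n" "?b m n \<le> 1" if "0 < n" for m n
    using blaschke_abs_le_1[OF y, of "Complex 0 (real n)" m] that by auto
  have lim: "(\<lambda>N. \<Prod>m\<le>N. ?b m n) \<longlonglongrightarrow> exp (2 * \<sigma> * real n) * cmod (Theta (Complex 0 (real n)))" if n: "0 < n" for n
  proof -
    let ?z = "Complex 0 (real n)"
    have z: "Im ?z > 0" using n by simp
    have "cmod (star_fun E ?z) / cmod (E ?z) = cmod (Theta ?z)"
      using Theta_eq[of ?z] E_nonzero[OF z] by (simp add: norm_mult)
    then show ?thesis
      using blaschke_product_limit[OF y prod_conv[rule_format] repr[rule_format] gamma G_real z E_nonzero[OF z]]
      by simp
  qed
  \<comment> \<open>All Blaschke moduli are at most 1, so the partial products decrease and each of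
    them bounds the limit from above.\<close>
  have upper: "exp (2 * \<sigma> * real n) * cmod (Theta (Complex 0 (real n))) \<le> (\<Prod>m<N. ?b m n)" if n: "0 < n" for n N
  proof (rule tendsto_upperbound[OF lim[OF n]])
    show "\<forall>\<^sub>F M in sequentially. (\<Prod>m\<le>M. ?b m n) \<le> (\<Prod>m<N. ?b m n)"
      using eventually_ge_at_top[of N]
    proof eventually_elim
      case (elim M)
      have "(\<Prod>m\<le>M. ?b m n) = (\<Prod>m<N. ?b m n) * (\<Prod>m\<in>{N..M}. ?b m n)"
        using elim by (subst prod.union_disjoint[symmetric]) (auto intro!: prod.cong)
      also have "\<dots> \<le> (\<Prod>m<N. ?b m n) * 1"
        using b01[OF n] by (intro mult_left_mono prod_le_1 prod_nonneg) auto
      finally show ?case by simp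
    qed
  qed simp
  show ?thesis
  proof
    assume dense: "mult_z_densely_defined E"
    show "\<sigma> > 0 \<or> \<not> summable (\<lambda>m. Im (zs m))"
    proof (rule ccontr)
      assume "\<not> ?thesis"
      then have \<sigma>0: "\<sigma> = 0" and s: "summable (\<lambda>m. Im (zs m))" using sigma by auto
      have "real n * defect n \<le> 4 * (\<Sum>m. Im (zs m))" if n: "0 < n" for n
      proof -
        have "(\<lambda>N. real n * (1 - (\<Prod>m\<le>N. ?b m n)\<^sup>2)) \<longlonglongrightarrow> real n * defect n"
          using lim[OF n] unfolding defect_def \<sigma>0 by (intro tendsto_intros) simp
        moreover have "real n * (1 - (\<Prod>m\<le>N. ?b m n)\<^sup>2) \<le> 4 * (\<Sum>m. Im (zs m))" for N
        proof -
          have d: "real n * (1 - (?b m n)\<^sup>2) \<le> 4 * Im (zs m)" for m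
          proof -
            let ?x = "Re (zs m)" and ?y = "Im (zs m)"
            have pos: "?x\<^sup>2 + (real n + ?y)\<^sup>2 > 0" using y[of m] n by (simp add: add_nonneg_pos)
            have "real n * (1 - (?b m n)\<^sup>2) = 4 * ?y * ((real n)\<^sup>2 / (?x\<^sup>2 + (real n + ?y)\<^sup>2))"
              by (rule blaschke_abs_axis[OF y])
            also have "\<dots> \<le> 4 * ?y * 1"
            proof (intro mult_left_mono)
              have "(real n)\<^sup>2 \<le> (real n + ?y)\<^sup>2" using y[of m] by (intro power_mono) auto
              then have "(real n)\<^sup>2 \<le> ?x\<^sup>2 + (real n + ?y)\<^sup>2"
                using zero_le_power2[of ?x] by linarith
              then show "(real n)\<^sup>2 / (?x\<^sup>2 + (real n + ?y)\<^sup>2) \<le> 1"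
                using pos by (simp add: divide_le_eq_1)
            qed (use y[of m] in simp)
            finally show ?thesis by simp
          qed
          \<comment> \<open>The Weierstrass inequality bounds the defect of a product by the sum of
            the defects of its factors.\<close>
          have "1 - (\<Sum>m\<le>N. 1 - (?b m n)\<^sup>2) \<le> (\<Prod>m\<le>N. 1 - (1 - (?b m n)\<^sup>2))"
            using b01[OF n] by (intro Weierstrass_prod_ineq) (auto simp: power_le_one)
          then have "1 - (\<Prod>m\<le>N. ?b m n)\<^sup>2 \<le> (\<Sum>m\<le>N. 1 - (?b m n)\<^sup>2)"
            by (simp add: prod_power_distrib)
          then have "real n * (1 - (\<Prod>m\<le>N. ?b m n)\<^sup>2) \<le> (\<Sum>m\<le>N. real n * (1 - (?b m n)\<^sup>2))"
            unfolding sum_distrib_left[symmetric] by (intro mult_left_mono) auto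
          also have "\<dots> \<le> (\<Sum>m\<le>N. 4 * Im (zs m))"
            by (intro sum_mono d)
          also have "\<dots> \<le> 4 * (\<Sum>m. Im (zs m))"
            unfolding sum_distrib_left[symmetric]
            using sum_le_suminf[OF s, of "{..N}"] y by (simp add: less_imp_le)
          finally show ?thesis .
        qed
        ultimately show ?thesis by (blast intro: LIMSEQ_le_const2)
      qed
      from not_mult_z_densely_defined[OF this] dense show False by simp
    qed
  next
    assume asm: "\<sigma> > 0 \<or> \<not> summable (\<lambda>m. Im (zs m))"
    show "mult_z_densely_defined E"
    proof (rule mult_z_densely_defined_if)
      show "filterlim (\<lambda>n. real n * defect n) at_top sequentially"
      proof (cases "\<sigma> > 0")
        case True
        then have "filterlim (\<lambda>n. real n * (1 - (exp (- 2 * \<sigma> * real n))\<^sup>2)) at_top sequentially"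
          by real_asymp
        then show ?thesis
        proof (rule filterlim_at_top_mono)
          show "\<forall>\<^sub>F n in sequentially. real n * (1 - (exp (- 2 * \<sigma> * real n))\<^sup>2) \<le> real n * defect n"
            using eventually_gt_at_top[of 0]
          proof eventually_elim
            case (elim n)
            \<comment> \<open>The empty product \<open>N = 0\<close> in \<open>upper\<close> leaves
              the exponential decay alone.\<close>
            have "cmod (Theta (Complex 0 (real n))) \<le> exp (- 2 * \<sigma> * real n)"
              using upper[OF elim, of 0] by (simp add: exp_minus field_simps)
            then show ?case
              unfolding defect_def by (intro mult_left_mono diff_left_mono power_mono) auto
          qed
        qed
      next
        case False
        with asm have ns: "\<not> summable (\<lambda>m. Im (zs m))" by simp
        show ?thesis
          unfolding filterlim_at_top
        proof
          fix Z :: real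
          obtain N where N: "Z < (\<Sum>m<N. Im (zs m))" "0 < (\<Sum>m<N. Im (zs m))"
          proof -
            \<comment> \<open>For positive terms, failure of summability means unbounded partial
              sums. Positivity of the sum permits the step from \<open>Z\<close> below it to
              \<open>Z\<close> below four times it.\<close>
            have "\<exists>N. max Z 0 < (\<Sum>m<N. Im (zs m))"
              using summableI_nonneg_bounded[of "\<lambda>m. Im (zs m)" "max Z 0"] ns y
              by (meson less_imp_le not_le)
            then show thesis using that by auto
          qed
          have "Z < 4 * (\<Sum>m<N. Im (zs m))" using N by linarith
          from order_tendstoD(1)[OF blaschke_defect_limit[OF y] this]
          show "\<forall>\<^sub>F n in sequentially. Z \<le> real n * defect n"
            using eventually_gt_at_top[of 0]
          proof eventually_elim
            case (elim n)
            \<comment> \<open>Finitely many zeros already give a lower bound for the defect, whose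
              limit in \<open>n\<close> is four times the chosen partial sum.\<close>
            have "cmod (Theta (Complex 0 (real n))) \<le> exp (2 * \<sigma> * real n) * cmod (Theta (Complex 0 (real n)))"
              using sigma by (simp add: mult_le_cancel_right1)
            also have "\<dots> \<le> (\<Prod>m<N. ?b m n)" by (rule upper[OF elim(2)])
            finally have "(cmod (Theta (Complex 0 (real n))))\<^sup>2 \<le> (\<Prod>m<N. (?b m n)\<^sup>2)"
              unfolding prod_power_distrib[symmetric] by (intro power_mono) auto
            then have "real n * (1 - (\<Prod>m<N. (?b m n)\<^sup>2)) \<le> real n * defect n"
              unfolding defect_def by (intro mult_left_mono diff_left_mono) auto
            with elim(1) show ?case by linarith
          qed
        qed
      qed
    qed
  qed
qed

end
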